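(* Let $\sigma$ and $\tau$ be types of a positive integer $n$. The coefficient of $h^\otimes_\tau$ in the $h^\otimes$-expansion of $E^+_\sigma$ is $\sum_{T^*}\mathrm{psgn}^*_+(T^* )$, where the sum is over all labeled polywrapping block tabloids $T^*$ of shape $\sigma$ and content $\tau$.
   Context: **Types.** A composition is a finite (possibly empty) list $\beta$ of positive integers, with $\mathrm{area}(\beta)$ the sum of its entries and $\ell(\beta)$ its length. A partition is a weakly decreasing composition; $\mathrm{sort}(\beta)$ is the partition obtained by sorting $\beta$. An ordered type of $n$ is a sequence $\delta=(\delta|_1,\delta|_2,\ldots)$ of compositions with $\sum_i i\,\mathrm{area}(\delta|_i)=n$, written $\delta=1^{\delta|_1}2^{\delta|_2}\cdots$; $\ell(\delta)=\sum_i\ell(\delta|_i)$ and $\mathrm{area}(\delta)=\sum_i\mathrm{area}(\delta|_i)$. A type is an ordered type with all $\delta|_i$ partitions, and $\mathrm{psort}(\delta)$ is the type obtained by replacing each $\delta|_i$ by $\mathrm{sort}(\delta|_i)$. A block $d^r$ ($d,r\ge1$) is the ordered type with $\delta|_d=(r)$ and all other $\delta|_i$ empty. A type $\tau$ is identified with the multiset of its blocks (one copy of $d^r$ for each part $r$ of $\tau|_d$), and we list its blocks as $d_1^{r_1}\cdots d_k^{r_k}$. An $r$-ordered type is an ordered type $\delta$ with $\mathrm{area}(\delta|_i)$ divisible by $r$ for all $i$; $\mathrm{OTyp}_r(n)$ is the set of $r$-ordered types of $n$. **Polysymmetric functions.** Let $x_{ij}$ ($i,j\ge1$) be commuting indeterminates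 with $\deg x_{ij}=i$. $\mathrm{PSym}$ is the $\mathbb{Q}$-algebra of bounded-degree formal power series in the $x_{ij}$ invariant under swapping $x_{ij}$ and $x_{ik}$ for all $i,j,k$; $\mathrm{PSym}(n)$ is its degree $n$ part. For an ordered type $\delta$, $h^\otimes_\delta=\prod_i h_{\delta|_i}(x_{i1},x_{i2},\ldots)$ where $h_\beta=\prod_j h_{\beta_j}$; $\{h^\otimes_\tau\}$ over types $\tau$ of $n$ is a basis of $\mathrm{PSym}(n)$, and the $h^\otimes$-expansion is the expansion in this basis. $E^+_d$ is the sum of all square-free monomials of degree $d$ in the $x_{ij}$; $E^+_{d^r}$ is obtained from $E^+_d$ by replacing each $x_{ij}$ by $x_{ij}^r$; $E^+_\sigma=\prod_{i=1}^kE^+_{d_i^{r_i}}$ for $\sigma=d_1^{r_1}\cdots d_k^{r_k}$. **The function $\hat{s}_r$.** For an $r$-tuple $w=(w_0,\ldots,w_{r-1})$ of non-negative integers, let $v_i$ be the remainder of $w_i+i$ upon division by $r$; $\hat{s}_r(w)=(-1)^{\#\{i<j:\,v_i>v_j\}}$ if the $v_i$ are distinct, and $0$ otherwise. For a composition $\beta$ with $\ell(\beta)\le r$, $\hat{s}_r(\beta)=\sum_w\hat{s}_r(w)$ over all $r$-tuples $w$ of non-negative integers that become $\beta$ on deleting zeros; if $\ell(\beta)>r$, $\hat{s}_r(\beta)=0$. For an ordered type $\delta$, $\hat{s}_r(\delta)=\prod_i\hat{s}_r(\delta|_i)$. **Wrappings and polywrappings.** View the block $d^r$ as an array of boxes with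 $d$ rows and $r$ columns. For $k\mid d$, divide the rows from top to bottom into $d/k$ "$k$-sheets" of $k$ consecutive rows; list the $dr/k$ columns of $k$-sheets in reading order (first sheet left to right, then second sheet left to right, etc.). For a composition $\beta=(\beta_1,\ldots,\beta_l)$ of $dr/k$, the $k$-wrapping of $d^r$ of content $\beta$ is the set partition $(B_1,\ldots,B_l)$ of the boxes where $B_1$ is the first $\beta_1$ sheet-columns, $B_2$ the next $\beta_2$, etc.; the $B_j$ are called rectangles of height $k$. Given $\gamma\in\mathrm{OTyp}_r(dr)$, the polywrapping $D$ of $d^r$ of ordered content $\gamma$ is obtained by dividing the $d$ rows, from top to bottom for $k=1,2,\ldots$, into consecutive groups of $k\,\mathrm{area}(\gamma|_k)/r$ rows, and putting on the $k$th group the $k$-wrapping $D_k$ of content $\gamma|_k$. **Labeled polywrappings.** A labeled polywrapping $D^*$ of $d^r$ of ordered content $\mathrm{pocon}(D^* )=\gamma$ is the polywrapping $D$ of ordered content $\gamma$ together with, for each $k$, a labeling of the rectangles of height $k$ by labels from $\{1,\ldots,r\}$ such that, reading the rectangles $B_1,B_2,\ldots$ of $D_k$ in order, the labels start at $1$, weakly increase, and use consecutive values (not all values in $\{1,\ldots,r\}$ need occur). The ordered type of the labeling is the ordered type $\delta$ for which the $i$th entry of $\delta|_k$ is the total number of boxes in the height-$k$ rectangles labeled $i$, divided by $k$. Set $\mathrm{psgn}^*_+(D^* )=(-1)^{\ell(\gamma)}(-1)^{\mathrm{area}(\delta)/r}\,\hat{s}_r(\delta)$. **Labeled polywrapping block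 tabloids.** A labeled polywrapping block tabloid $T^*$ of shape $\sigma=d_1^{r_1}\cdots d_k^{r_k}$ and content $\tau$ is a list $(D^*_{(1)},\ldots,D^*_{(k)})$ where $D^*_{(i)}$ is a labeled polywrapping of $d_i^{r_i}$ and the multiset union of the blocks of $\mathrm{psort}(\mathrm{pocon}(D^*_{(i)}))$, $1\le i\le k$, equals $\tau$. Set $\mathrm{psgn}^*_+(T^* )=\prod_{i=1}^k\mathrm{psgn}^*_+(D^*_{(i)})$. *)

theory Defs
  imports Complex_Main "HOL-Library.Poly_Mapping" "HOL-Library.Multiset"
begin

section \<open>Formal power series in the doubly indexed variables\<close>

text \<open>
  A monomial is a finitely supported exponent function on pairs \<open>(i, j)\<close>; a formal power series
  in infinitely many variables is an arbitrary function from monomials to rational coefficients.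
  The pair \<open>(i, j)\<close> stands for the variable \<open>x\<^sub>i\<^sub>j\<close>, of degree \<open>i\<close>.  Only \<open>i, j \<ge> 1\<close> are
  variables of interest; the series below do not involve the pairs with a zero index.
\<close>

type_synonym monom = "(nat \<times> nat) \<Rightarrow>\<^sub>0 nat"

typedef series = "UNIV :: (monom \<Rightarrow> rat) set"
  morphisms coeff Series ..

setup_lifting type_definition_series

lemma coeff_Series [simp]: "coeff (Series f) = f"
  by (simp add: Series_inverse)

lemma series_eqI: "(\<And>m. coeff f m = coeff g m) \<Longrightarrow> f = g"
  by (metis coeff_inject ext)

lemma finite_splittings: "finite {(a, b). a + b = (m :: monom)}"
proof -
  let ?S = "{(a, b). a + b = m}"
  let ?M = "Max (insert 0 (Poly_Mapping.lookup m ` Poly_Mapping.keys m))"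
  let ?F = "{f. \<forall>x. (x \<in> Poly_Mapping.keys m \<longrightarrow> f x \<in> {..?M})
                    \<and> (x \<notin> Poly_Mapping.keys m \<longrightarrow> f x = (0::nat))}"
  have "inj_on (\<lambda>p. Poly_Mapping.lookup (fst p)) ?S"
  proof (rule inj_onI)
    fix p q assume "p \<in> ?S" "q \<in> ?S"
      and "Poly_Mapping.lookup (fst p) = Poly_Mapping.lookup (fst q)"
    then have "fst p = fst q" and "fst p + snd p = fst q + snd q"
      by (auto intro: poly_mapping_eqI)
    then show "p = q" by (simp add: prod_eq_iff)
  qed
  moreover have "Poly_Mapping.lookup a \<in> ?F" if "a + b = m" for a b
  proof -
    have le: "Poly_Mapping.lookup a x \<le> Poly_Mapping.lookup m x" for x
      using that by (auto simp: lookup_add)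
    have "Poly_Mapping.lookup a x \<le> ?M" if "x \<in> Poly_Mapping.keys m" for x
      by (rule order_trans[OF le]) (use that in \<open>intro Max_ge; simp\<close>)
    moreover have "Poly_Mapping.lookup a x = 0" if "x \<notin> Poly_Mapping.keys m" for x
      using le[of x] that by (simp add: in_keys_iff)
    ultimately show ?thesis by simp
  qed
  then have "(\<lambda>p. Poly_Mapping.lookup (fst p)) ` ?S \<subseteq> ?F"
    by (intro image_subsetI) (simp add: case_prod_unfold)
  moreover have "finite ?F"
    by (rule finite_set_of_finite_funs) auto
  ultimately show ?thesis
    by (meson finite_imageD finite_subset)
qed

instantiation series :: comm_ring_1
begin

lift_definition zero_series :: series is "\<lambda>_. 0" .
lift_definition one_series :: series is "\<lambda>m. if m = 0 then 1 else 0" .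
lift_definition plus_series :: "series \<Rightarrow> series \<Rightarrow> series" is "\<lambda>f g m. f m + g m" .
lift_definition minus_series :: "series \<Rightarrow> series \<Rightarrow> series" is "\<lambda>f g m. f m - g m" .
lift_definition uminus_series :: "series \<Rightarrow> series" is "\<lambda>f m. - f m" .
lift_definition times_series :: "series \<Rightarrow> series \<Rightarrow> series" is
  "\<lambda>f g m. \<Sum>(a, b) | a + b = m. f a * g b" .

instance
proof
  fix f g h :: series
  show "f * g * h = f * (g * h)"
  proof transfer
    fix f g h :: "monom \<Rightarrow> rat"
    have "(\<Sum>(p, c) | p + c = m. (\<Sum>(a, b) | a + b = p. f a * g b) * h c)
        = (\<Sum>(a, q) | a + q = m. f a * (\<Sum>(b, c) | b + c = q. g b * h c))" (is "?L = ?R") for m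
    proof -
      have "?L = (\<Sum>x\<in>{(p, c). p + c = m}. \<Sum>y\<in>{(a, b). a + b = fst x}.
                    f (fst y) * g (snd y) * h (snd x))"
        by (simp add: case_prod_unfold sum_distrib_right)
      also have "\<dots> = (\<Sum>z\<in>(SIGMA x:{(p, c). p + c = m}. {(a, b). a + b = fst x}).
                    f (fst (snd z)) * g (snd (snd z)) * h (snd (fst z)))"
        by (subst sum.Sigma) (use finite_splittings in \<open>auto simp: case_prod_unfold\<close>)
      also have "\<dots> = (\<Sum>z\<in>(SIGMA x:{(a, q). a + q = m}. {(b, c). b + c = snd x}).
                    f (fst (fst z)) * (g (fst (snd z)) * h (snd (snd z))))"
        by (rule sum.reindex_bij_witness
              [where j = "\<lambda>((p, c), (a, b)). ((a, b + c), (b, c))"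
                 and i = "\<lambda>((a, q), (b, c)). ((a + b, c), (a, b))"])
           (auto simp: ac_simps)
      also have "\<dots> = (\<Sum>x\<in>{(a, q). a + q = m}. \<Sum>y\<in>{(b, c). b + c = snd x}.
                    f (fst x) * (g (fst y) * h (snd y)))"
        by (subst sum.Sigma) (use finite_splittings in \<open>auto simp: case_prod_unfold\<close>)
      also have "\<dots> = ?R"
        by (simp add: case_prod_unfold sum_distrib_left)
      finally show ?thesis .
    qed
    then show "(\<lambda>m. \<Sum>(p, c) | p + c = m. (\<Sum>(a, b) | a + b = p. f a * g b) * h c)
        = (\<lambda>m. \<Sum>(a, q) | a + q = m. f a * (\<Sum>(b, c) | b + c = q. g b * h c))"
      by (rule ext)
  qed
  show "f * g = g * f"
  proof transfer
    fix f g :: "monom \<Rightarrow> rat"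
    have "(\<Sum>(a, b) | a + b = m. f a * g b) = (\<Sum>(a, b) | a + b = m. g a * f b)" for m
      by (rule sum.reindex_bij_witness[where i = "\<lambda>(a, b). (b, a)" and j = "\<lambda>(a, b). (b, a)"])
         (auto simp: ac_simps)
    then show "(\<lambda>m. \<Sum>(a, b) | a + b = m. f a * g b) = (\<lambda>m. \<Sum>(a, b) | a + b = m. g a * f b)"
      by (rule ext)
  qed
  show "1 * f = f"
  proof transfer
    fix f :: "monom \<Rightarrow> rat"
    have "(\<Sum>(a, b) | a + b = m. (if a = 0 then 1 else 0) * f b) = f m" for m
    proof -
      have "(\<Sum>(a, b) | a + b = m. (if a = 0 then 1 else 0) * f b)
          = (\<Sum>(a, b)\<in>{(0 :: monom, m)}. (if a = 0 then 1 else 0) * f b)"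
        by (rule sum.mono_neutral_right) (auto simp: finite_splittings split: if_splits)
      then show ?thesis by simp
    qed
    then show "(\<lambda>m. \<Sum>(a, b) | a + b = m. (if a = 0 then 1 else 0) * f b) = f"
      by (rule ext)
  qed
  show "(f + g) * h = f * h + g * h"
    by transfer (simp add: distrib_right case_prod_unfold sum.distrib)
  show "(0::series) \<noteq> 1"
    by transfer (auto simp: fun_eq_iff)
qed (transfer; simp add: algebra_simps)+

end

lift_definition scale :: "rat \<Rightarrow> series \<Rightarrow> series" is "\<lambda>c f m. c * f m" .

global_interpretation series: vector_space scale
  by standard (transfer; simp add: algebra_simps)+

section \<open>Compositions, ordered types and types\<close>

text \<open>
  An ordered type is a function on \<open>nat\<close>; as its components are indexed by \<open>i \<ge> 1\<close>, the
  component at \<open>0\<close> is required to be empty.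
\<close>

type_synonym otype = "nat \<Rightarrow> nat list"

definition composition :: "nat list \<Rightarrow> bool" where
  "composition \<beta> \<longleftrightarrow> (\<forall>b\<in>set \<beta>. b > 0)"

definition is_partition :: "nat list \<Rightarrow> bool" where
  "is_partition \<beta> \<longleftrightarrow> composition \<beta> \<and> sorted_wrt (\<ge>) \<beta>"

abbreviation area :: "nat list \<Rightarrow> nat" where
  "area \<equiv> sum_list"

definition supp :: "otype \<Rightarrow> nat set" where
  "supp \<delta> = {i. \<delta> i \<noteq> []}"

definition ordered_types :: "nat \<Rightarrow> otype set" where
  "ordered_types n = {\<delta>. finite (supp \<delta>) \<and> \<delta> 0 = [] \<and> (\<forall>i. composition (\<delta> i))
     \<and> (\<Sum>i\<in>supp \<delta>. i * area (\<delta> i)) = n}"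

definition types :: "nat \<Rightarrow> otype set" where
  "types n = {\<delta> \<in> ordered_types n. \<forall>i. is_partition (\<delta> i)}"

definition OTyp :: "nat \<Rightarrow> nat \<Rightarrow> otype set" where
  "OTyp r n = {\<delta> \<in> ordered_types n. \<forall>i. r dvd area (\<delta> i)}"

definition otype_length :: "otype \<Rightarrow> nat" where
  "otype_length \<delta> = (\<Sum>i\<in>supp \<delta>. length (\<delta> i))"

definition otype_area :: "otype \<Rightarrow> nat" where
  "otype_area \<delta> = (\<Sum>i\<in>supp \<delta>. area (\<delta> i))"

definition psort :: "otype \<Rightarrow> otype" where
  "psort \<delta> = (\<lambda>i. rev (sort (\<delta> i)))"

text \<open>The block \<open>d\<^sup>r\<close> is encoded as the pair \<open>(d, r)\<close>.\<close>

definition blocks :: "otype \<Rightarrow> (nat \<times> nat) multiset" where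
  "blocks \<tau> = (\<Sum>d\<in>supp \<tau>. image_mset (Pair d) (mset (\<tau> d)))"

section \<open>The polysymmetric functions\<close>

definition monom_degree :: "monom \<Rightarrow> nat" where
  "monom_degree m = (\<Sum>(i, j)\<in>Poly_Mapping.keys m. i * Poly_Mapping.lookup m (i, j))"

text \<open>The complete homogeneous symmetric function of degree \<open>k\<close> in \<open>x\<^sub>i\<^sub>1, x\<^sub>i\<^sub>2, \<dots>\<close>, for fixed \<open>i\<close>.\<close>

definition complete_h :: "nat \<Rightarrow> nat \<Rightarrow> series" where
  "complete_h i k = Series (\<lambda>m. if Poly_Mapping.keys m \<subseteq> {i} \<times> {1..}
     \<and> (\<Sum>v\<in>Poly_Mapping.keys m. Poly_Mapping.lookup m v) = k then 1 else 0)"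

definition h_tensor :: "otype \<Rightarrow> series" where
  "h_tensor \<delta> = (\<Prod>i\<in>supp \<delta>. \<Prod>b\<leftarrow>\<delta> i. complete_h i b)"

text \<open>
  The library's \<open>representation\<close> is \<open>0\<close> on a linearly dependent set or off the span; this default
  plays no role here, as the \<open>h_tensor \<delta>\<close> over the types \<open>\<delta>\<close> of \<open>n\<close> are distinct and form a basis
  of the homogeneous polysymmetric functions of degree \<open>n\<close>.
\<close>

definition h_coefficient :: "nat \<Rightarrow> series \<Rightarrow> otype \<Rightarrow> rat" where
  "h_coefficient n f \<tau> = series.representation (h_tensor ` types n) f (h_tensor \<tau>)"

definition E_plus_degree :: "nat \<Rightarrow> series" where
  "E_plus_degree d = Series (\<lambda>m. if Poly_Mapping.keys m \<subseteq> {1..} \<times> {1..}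
     \<and> (\<forall>v. Poly_Mapping.lookup m v \<le> 1) \<and> monom_degree m = d then 1 else 0)"

text \<open>Substitution of \<open>x\<^sub>i\<^sub>j\<^sup>r\<close> for every \<open>x\<^sub>i\<^sub>j\<close>, for \<open>r \<ge> 1\<close>.\<close>

definition power_subst :: "nat \<Rightarrow> series \<Rightarrow> series" where
  "power_subst r f = Series (\<lambda>m. if \<forall>v. r dvd Poly_Mapping.lookup m v
     then coeff f (Poly_Mapping.map (\<lambda>e. e div r) m) else 0)"

definition E_plus_block :: "nat \<Rightarrow> nat \<Rightarrow> series" where
  "E_plus_block d r = power_subst r (E_plus_degree d)"

definition E_plus :: "otype \<Rightarrow> series" where
  "E_plus \<sigma> = (\<Prod>(d, r)\<in>#blocks \<sigma>. E_plus_block d r)"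

section \<open>The sign function\<close>

definition s_hat_tuple :: "nat \<Rightarrow> nat list \<Rightarrow> int" where
  "s_hat_tuple r w = (let v = (\<lambda>i. (w ! i + i) mod r) in
     if inj_on v {..<r} then (-1) ^ card {(i, j). i < j \<and> j < r \<and> v i > v j} else 0)"

definition s_hat :: "nat \<Rightarrow> nat list \<Rightarrow> int" where
  "s_hat r \<beta> = (if length \<beta> \<le> r
     then \<Sum>w | length w = r \<and> filter (\<lambda>x. x \<noteq> 0) w = \<beta>. s_hat_tuple r w else 0)"

text \<open>Empty components contribute the factor \<open>1\<close>, so the product may be taken over the support.\<close>

lemma s_hat_Nil: "s_hat r [] = 1"
proof -
  have "{w. length w = r \<and> filter (\<lambda>x. x \<noteq> 0) w = []} = {replicate r (0::nat)}"
    by (auto simp: filter_empty_conv intro!: replicate_eqI)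
  moreover have "s_hat_tuple r (replicate r 0) = 1"
  proof -
    have v: "(replicate r 0 ! i + i) mod r = i" if "i < r" for i
      using that by simp
    have "{(i, j). i < j \<and> j < r
        \<and> (replicate r 0 ! i + i) mod r > (replicate r 0 ! j + j) mod r} = {}"
      by (auto simp: v)
    moreover have "inj_on (\<lambda>i. (replicate r 0 ! i + i) mod r) {..<r}"
      by (rule inj_onI) (simp add: v)
    ultimately show ?thesis
      by (simp only: s_hat_tuple_def Let_def if_True card.empty power_0)
  qed
  ultimately show ?thesis by (simp add: s_hat_def)
qed

definition s_hat_otype :: "nat \<Rightarrow> otype \<Rightarrow> int" where
  "s_hat_otype r \<delta> = (\<Prod>i\<in>supp \<delta>. s_hat r (\<delta> i))"

section \<open>Wrappings and labeled polywrappings\<close>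

text \<open>
  Boxes are pairs (row, column), both counted from \<open>0\<close>, rows from top to bottom.
  \<open>sheet_columns t d r k\<close> lists, in reading order, the columns of \<open>k\<close>-sheets of the array
  consisting of the \<open>d\<close> rows starting at row \<open>t\<close>.
\<close>

type_synonym box = "nat \<times> nat"

definition sheet_columns :: "nat \<Rightarrow> nat \<Rightarrow> nat \<Rightarrow> nat \<Rightarrow> box set list" where
  "sheet_columns t d r k =
     [{t + s * k ..< t + (s + 1) * k} \<times> {c}. s \<leftarrow> [0..<d div k], c \<leftarrow> [0..<r]]"

fun group_columns :: "nat list \<Rightarrow> box set list \<Rightarrow> box set list" where
  "group_columns [] cs = []"
| "group_columns (b # \<beta>) cs = \<Union> (set (take b cs)) # group_columns \<beta> (drop b cs)"

definition wrapping :: "nat \<Rightarrow> nat \<Rightarrow> nat \<Rightarrow> nat \<Rightarrow> nat list \<Rightarrow> box set list" where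
  "wrapping t d r k \<beta> = group_columns \<beta> (sheet_columns t d r k)"

definition group_rows :: "nat \<Rightarrow> otype \<Rightarrow> nat \<Rightarrow> nat" where
  "group_rows r \<gamma> k = k * area (\<gamma> k) div r"

text \<open>
  The list at index \<open>k\<close> consists of the rectangles of height \<open>k\<close>.  The number of rows of the array
  is not an argument: it is \<open>d\<close> when \<open>\<gamma> \<in> OTyp r (d * r)\<close>.
\<close>

definition polywrapping :: "nat \<Rightarrow> otype \<Rightarrow> nat \<Rightarrow> box set list" where
  "polywrapping r \<gamma> k = wrapping (\<Sum>i<k. group_rows r \<gamma> i) (group_rows r \<gamma> k) r k (\<gamma> k)"

definition labeling :: "nat \<Rightarrow> nat list \<Rightarrow> bool" where
  "labeling r L \<longleftrightarrow> set L \<subseteq> {1..r} \<and> (L \<noteq> [] \<longrightarrow> hd L = 1) \<and> sorted L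
     \<and> (\<forall>j. Suc j < length L \<longrightarrow> L ! Suc j \<le> L ! j + 1)"

record labeled_polywrapping =
  pocon :: otype
  rectangles :: "nat \<Rightarrow> box set list"
  labels :: "nat \<Rightarrow> nat list"

definition labeled_polywrappings :: "nat \<Rightarrow> nat \<Rightarrow> labeled_polywrapping set" where
  "labeled_polywrappings d r = {D. pocon D \<in> OTyp r (d * r)
     \<and> rectangles D = polywrapping r (pocon D)
     \<and> (\<forall>k. length (labels D k) = length (rectangles D k) \<and> labeling r (labels D k))}"

text \<open>The labels in use at height \<open>k\<close> are \<open>1, \<dots>, m\<close> where \<open>m\<close> is their number.\<close>

definition label_type :: "labeled_polywrapping \<Rightarrow> otype" where
  "label_type D = (\<lambda>k. map
     (\<lambda>i. (\<Sum>j | j < length (labels D k) \<and> labels D k ! j = i. card (rectangles D k ! j)) div k)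
     [1..<Suc (card (set (labels D k)))])"

definition psgn_polywrapping :: "nat \<Rightarrow> labeled_polywrapping \<Rightarrow> int" where
  "psgn_polywrapping r D = (-1) ^ otype_length (pocon D)
     * (-1) ^ (otype_area (label_type D) div r) * s_hat_otype r (label_type D)"

section \<open>Labeled polywrapping block tabloids\<close>

text \<open>The shape is given by a list \<open>bs\<close> of the blocks of a type, the content by a type.\<close>

definition tabloids :: "(nat \<times> nat) list \<Rightarrow> otype \<Rightarrow> labeled_polywrapping list set" where
  "tabloids bs \<tau> = {T. list_all2 (\<lambda>D (d, r). D \<in> labeled_polywrappings d r) T bs
     \<and> (\<Sum>D\<leftarrow>T. blocks (psort (pocon D))) = blocks \<tau>}"

definition psgn_tabloid :: "(nat \<times> nat) list \<Rightarrow> labeled_polywrapping list \<Rightarrow> int" where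
  "psgn_tabloid bs T = (\<Prod>((d, r), D)\<leftarrow>zip bs T. psgn_polywrapping r D)"

end

theory Submission
  imports "HOL-Computational_Algebra.Formal_Power_Series" "Jordan_Normal_Form.Determinant" Defs
begin

hide_const (open) Polynomial.coeff

text \<open>
  For fixed \<open>i\<close>, put \<open>F(t) = \<Prod>\<^sub>j (1 - x\<^sub>i\<^sub>j t)\<close>.  Multiplication by \<open>F\<close> on power series, regarded as a free module
  with basis \<open>1, t, \<dots>, t\<^bsup>r-1\<^esup>\<close> over the power series in \<open>t\<^sup>r\<close>, has determinant \<open>\<Prod>\<^sub>j (1 - x\<^sub>i\<^sub>j\<^sup>r t\<^sup>r)\<close>
  by multiplicativity.  In the Leibniz expansion of this determinant the exponents \<open>w\<close> occur with
  the sign \<open>s_hat_tuple r w\<close>, which expresses \<open>e\<^sub>m(x\<^sub>i\<^sub>1\<^sup>r, x\<^sub>i\<^sub>2\<^sup>r, \<dots>)\<close> by products of the \<open>e\<^sub>b(x\<^sub>i\<^sub>1, x\<^sub>i\<^sub>2, \<dots>)\<close>.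
  Each \<open>(-1)\<^sup>b e\<^sub>b\<close> is the sum of \<open>(-1)\<^bsup>\<ell>(\<beta>)\<^esup> h\<^sub>\<beta>\<close> over the compositions \<open>\<beta>\<close> of \<open>b\<close>, and a choice of
  such a composition for every part of \<open>\<delta>\<close> is a composition with a labeling of its parts.
  Multiplying over all \<open>i\<close> turns these into labeled polywrappings.
\<close>

section \<open>The determinant of multiplication by a power series\<close>

text \<open>The \<open>sign\<close> in the Leibniz formula rests on transpositions, while
  \<open>s_hat_tuple\<close> counts inversions; \<open>inversion_sign\<close> links the two.
  Determinants and products over variables demand finitely many of them, so identities in infinitely
  many variables are checked after setting all but finitely many to 0. The sign of a labeled
  polywrapping has three sources: \<open>(-1) ^ otype_length\<close> of the content comes from
  expanding elementary into complete functions, the exponent \<open>otype_area div r\<close> from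
  the sign (-1)^m in front of e_m(x^r), and \<open>s_hat\<close> from the determinant. The heights
  separate because a square-free monomial of degree d is a choice, for every i, of m_i variables of
  degree i, where \<Sum> i m_i = d. The coefficient is meaningful only once the h-products are known
  to be independent. Independence is proved for the e-products, whose leading monomials give a
  triangular system, and carried over by counting.\<close>

definition inversion_sign :: "nat \<Rightarrow> (nat \<Rightarrow> nat) \<Rightarrow> int" where
  "inversion_sign n p = (\<Prod>(i, j) | i < j \<and> j < n. sgn (int (p j) - int (p i)))"

lemma finite_increasing_pairs: "finite {(i, j). i < j \<and> j < (n :: nat)}"
  by (rule finite_subset[of _ "{..<n} \<times> {..<n}"]) auto

lemma inversion_sign_card:
  assumes "inj_on p {..<n}"
  shows "inversion_sign n p = (-1) ^ card {(i, j). i < j \<and> j < n \<and> p i > p j}"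
proof -
  let ?P = "{(i, j). i < j \<and> j < n}"
  let ?Q = "{(i, j). i < j \<and> j < n \<and> p i > p j}"
  have "sgn (int (p j) - int (p i)) = (if p i > p j then -1 else 1)" if "i < j" "j < n" for i j
    using inj_onD[OF assms, of i j] that by (auto simp: sgn_if)
  then have "inversion_sign n p = (\<Prod>x\<in>?P. if x \<in> ?Q then -1 else 1)"
    unfolding inversion_sign_def by (intro prod.cong refl) (simp split: prod.splits)
  also have "\<dots> = (\<Prod>x\<in>?P \<inter> ?Q. -1)"
    by (subst prod.inter_restrict) (auto simp: finite_increasing_pairs)
  also have "?P \<inter> ?Q = ?Q" by auto
  finally show ?thesis by simp
qed

text \<open>Each factor for \<open>p \<circ> q\<close> splits into the factor for \<open>q\<close>
  at \<open>(i, j)\<close> and a quantity \<open>g (q i) (q j)\<close> that is symmetric in its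
  arguments. A symmetric function may be multiplied over unordered pairs, and \<open>q\<close> only
  permutes these.\<close>

lemma inversion_sign_comp:
  assumes p: "p permutes {..<n}" and q: "q permutes {..<n}"
  shows "inversion_sign n (p \<circ> q) = inversion_sign n p * inversion_sign n q"
proof -
  let ?P = "{(i, j). i < j \<and> j < n}"
  define g where "g a b = sgn (int (p b) - int (p a)) * sgn (int b - int a)" for a b
  have g_sym: "g a b = g b a" for a b
    by (auto simp: g_def sgn_if)
  define q' where "q' = inv_into UNIV q"
  have inj_q: "q x = q y \<longleftrightarrow> x = y" for x y
    using permutes_inj[OF q] by (auto dest: injD)
  have "inversion_sign n (p \<circ> q)
      = (\<Prod>(i, j)\<in>?P. g (q i) (q j) * sgn (int (q j) - int (q i)))"
    unfolding inversion_sign_def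
  proof (rule prod.cong)
    fix x :: "nat \<times> nat" assume "x \<in> {(i, j). i < j \<and> j < n}"
    then obtain i j where x: "x = (i, j)" "i < j" by auto
    then have "sgn (int (q j) - int (q i)) * sgn (int (q j) - int (q i)) = 1"
      using inj_q[of i j] by (auto simp: sgn_if)
    then show "(case x of (i, j) \<Rightarrow> sgn (int ((p \<circ> q) j) - int ((p \<circ> q) i)))
        = (case x of (i, j) \<Rightarrow> g (q i) (q j) * sgn (int (q j) - int (q i)))"
      by (simp add: x g_def mult.assoc)
  qed simp
  also have "\<dots> = (\<Prod>(i, j)\<in>?P. g (q i) (q j)) * inversion_sign n q"
    by (simp add: inversion_sign_def case_prod_unfold prod.distrib)
  \<comment> \<open>Unordered pairs are represented by increasing ones, hence \<open>min\<close> and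
    \<open>max\<close> in the reindexing.\<close>
  also have "(\<Prod>(i, j)\<in>?P. g (q i) (q j)) = (\<Prod>(i, j)\<in>?P. g i j)"
  proof (rule prod.reindex_bij_witness
      [where j = "\<lambda>(i, j). (min (q i) (q j), max (q i) (q j))"
         and i = "\<lambda>(i, j). (min (q' i) (q' j), max (q' i) (q' j))"])
    note permutes_q' = permutes_inv[OF q, folded q'_def]
    have q_less: "q x < n" "q' x < n" if "x < n" for x
      using permutes_in_image[OF q] permutes_in_image[OF permutes_q'] that by auto
    have inj_inv: "q' x = q' y \<longleftrightarrow> x = y" for x y
      using permutes_inj[OF permutes_q'] by (auto dest: injD)
    fix a assume a: "a \<in> ?P"
    obtain i j where ij: "a = (i, j)" "i < j" "j < n" using a by auto
    have ne: "q i \<noteq> q j" "q' i \<noteq> q' j" using ij inj_q inj_inv by auto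
    show "(case (case a of (i, j) \<Rightarrow> (min (q i) (q j), max (q i) (q j))) of
        (i, j) \<Rightarrow> (min (q' i) (q' j), max (q' i) (q' j))) = a"
      using ij permutes_inverses[OF q, folded q'_def] by (simp add: min_def max_def)
    show "(case (case a of (i, j) \<Rightarrow> (min (q' i) (q' j), max (q' i) (q' j))) of
        (i, j) \<Rightarrow> (min (q i) (q j), max (q i) (q j))) = a"
      using ij permutes_inverses[OF q, folded q'_def] by (simp add: min_def max_def)
    show "(case a of (i, j) \<Rightarrow> (min (q i) (q j), max (q i) (q j))) \<in> ?P"
      using ij ne q_less[of i] q_less[of j] by auto
    show "(case a of (i, j) \<Rightarrow> (min (q' i) (q' j), max (q' i) (q' j))) \<in> ?P"
      using ij ne q_less[of i] q_less[of j] by auto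
    show "(case (case a of (i, j) \<Rightarrow> (min (q i) (q j), max (q i) (q j))) of (i, j) \<Rightarrow> g i j)
        = (case a of (i, j) \<Rightarrow> g (q i) (q j))"
      using ij g_sym by (auto simp: min_def max_def)
  qed
  also have "(\<Prod>(i, j)\<in>?P. g i j) = inversion_sign n p"
    unfolding inversion_sign_def g_def by (intro prod.cong) auto
  finally show ?thesis .
qed

lemma inversion_sign_transpose_Suc:
  assumes "Suc b < n"
  shows "inversion_sign n (Transposition.transpose b (Suc b)) = -1"
proof -
  let ?t = "Transposition.transpose b (Suc b)"
  have "{(i, j). i < j \<and> j < n \<and> ?t i > ?t j} = {(b, Suc b)}"
    using assms by (auto simp: Transposition.transpose_def split: if_splits)
  moreover have "inj_on ?t {..<n}" by simp
  ultimately show ?thesis by (simp add: inversion_sign_card)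
qed

text \<open>An adjacent transposition has a single inversion. Conjugating by it moves
  \<open>b\<close> to \<open>Suc b\<close>, and a product of three signs -1 is -1.\<close>

lemma inversion_sign_transpose:
  assumes "a < b" "b < n"
  shows "inversion_sign n (Transposition.transpose a b) = -1"
  using assms
proof (induction b)
  case (Suc b)
  let ?s = "Transposition.transpose b (Suc b)" and ?t = "Transposition.transpose a b"
  show ?case
  proof (cases "a = b")
    case True
    with Suc.prems show ?thesis by (simp add: inversion_sign_transpose_Suc)
  next
    case False
    with Suc.prems have "a < b" by simp
    have "Transposition.transpose a (Suc b) = ?s \<circ> (?t \<circ> ?s)"
      using \<open>a < b\<close> by (auto simp: fun_eq_iff Transposition.transpose_def)
    moreover have "?s permutes {..<n}" "?t permutes {..<n}"
      using Suc.prems \<open>a < b\<close> by (auto intro!: permutes_swap_id)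
    moreover have "inversion_sign n ?t = -1" "inversion_sign n ?s = -1"
      using Suc \<open>a < b\<close> by (simp_all add: inversion_sign_transpose_Suc)
    ultimately show ?thesis
      using inversion_sign_comp[of ?t n ?s] inversion_sign_comp[of ?s n "?t \<circ> ?s"]
        permutes_compose[of ?s "{..<n}" ?t]
      by (simp del: comp_apply o_apply)
  qed
qed simp

lemma sign_eq_inversion_sign:
  assumes "p permutes {..<n}"
  shows "sign p = inversion_sign n p"
proof -
  \<comment> \<open>The induction along transpositions carries \<open>p permutes {..<n}\<close> with
    it, since \<open>inversion_sign_comp\<close> requires it of both factors.\<close>
  have "p permutes {..<n} \<and> sign p = inversion_sign n p"
    using assms finite_lessThan
  proof (induction rule: permutes_induct)
    case id
    have "inversion_sign n id = 1"
      unfolding inversion_sign_def by (rule prod.neutral) auto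
    then show ?case by (metis permutes_id sign_id)
  next
    case (swap a b p)
    have t: "Transposition.transpose a b permutes {..<n}"
      using swap by (auto intro!: permutes_swap_id)
    have "inversion_sign n (Transposition.transpose a b) = -1"
      using swap inversion_sign_transpose[of a b n] inversion_sign_transpose[of b a n]
      by (cases "a < b") (auto simp: transpose_commute)
    then have "inversion_sign n (Transposition.transpose a b \<circ> p) = - inversion_sign n p"
      using inversion_sign_comp[OF t, of p] swap by simp
    moreover have "sign (Transposition.transpose a b \<circ> p) = - sign p"
      using sign_compose[OF permutation_swap_id permutes_imp_permutation[OF finite_lessThan], of p n a b]
        swap by (simp add: sign_swap_id)
    moreover have "Transposition.transpose a b \<circ> p permutes {..<n}"
      using t swap by (intro permutes_compose) auto
    ultimately show ?case
      using swap by metis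
  qed
  then show ?thesis by blast
qed

text \<open>
  The matrix of multiplication by \<open>F\<close> with respect to the residues modulo \<open>r\<close> of the exponents.
\<close>

definition residue_matrix :: "nat \<Rightarrow> 'a::comm_ring_1 fps \<Rightarrow> 'a fps mat" where
  "residue_matrix r F = mat r r (\<lambda>(i, j). Abs_fps (\<lambda>n. if (n + i) mod r = j then fps_nth F n else 0))"

lemma residue_matrix_carrier [simp]: "residue_matrix r F \<in> carrier_mat r r"
  by (simp add: residue_matrix_def)

text \<open>Row \<open>i\<close>, column \<open>j\<close> holds the terms of the series that shift
  an exponent from residue \<open>i\<close> to residue \<open>j\<close>. Composing a shift by
  \<open>a\<close> with one by \<open>n - a\<close> forces the intermediate residue to be
  \<open>(a + i) mod r\<close>, so the inner sum of the matrix product has one term.\<close>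

lemma residue_matrix_mult:
  "residue_matrix r (F * G) = residue_matrix r F * residue_matrix r G"
proof (rule eq_matI)
  fix i k assume ik: "i < dim_row (residue_matrix r F * residue_matrix r G)"
    "k < dim_col (residue_matrix r F * residue_matrix r G)"
  then have ik': "i < r" "k < r" by (simp_all add: residue_matrix_def)
  have "fps_nth ((residue_matrix r F * residue_matrix r G) $$ (i, k)) n
      = fps_nth (residue_matrix r (F * G) $$ (i, k)) n" for n
  proof -
    have "fps_nth ((residue_matrix r F * residue_matrix r G) $$ (i, k)) n
        = (\<Sum>j<r. \<Sum>a=0..n. (if (a + i) mod r = j then fps_nth F a else 0)
              * (if (n - a + j) mod r = k then fps_nth G (n - a) else 0))"
      using ik' by (simp add: residue_matrix_def scalar_prod_def fps_sum_nth fps_mult_nth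
          atLeast0LessThan)
    also have "\<dots> = (\<Sum>a=0..n. \<Sum>j<r. (if j = (a + i) mod r then fps_nth F a *
                (if (n - a + j) mod r = k then fps_nth G (n - a) else 0) else 0))"
      by (subst sum.swap) (intro sum.cong refl, auto)
    also have "\<dots> = (\<Sum>a=0..n. fps_nth F a * (if (n + i) mod r = k then fps_nth G (n - a) else 0))"
    proof (intro sum.cong refl)
      fix a assume "a \<in> {0..n}"
      then have "(n - a + (a + i) mod r) mod r = (n + i) mod r"
        by (metis add.assoc atLeastAtMost_iff le_add_diff_inverse2 mod_add_right_eq)
      then show "(\<Sum>j<r. (if j = (a + i) mod r then fps_nth F a *
            (if (n - a + j) mod r = k then fps_nth G (n - a) else 0) else 0))
          = fps_nth F a * (if (n + i) mod r = k then fps_nth G (n - a) else 0)"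
        using ik' by (simp add: sum.delta)
    qed
    also have "\<dots> = fps_nth (residue_matrix r (F * G) $$ (i, k)) n"
      using ik' by (simp add: residue_matrix_def fps_mult_nth)
    finally show ?thesis .
  qed
  then show "residue_matrix r (F * G) $$ (i, k) = (residue_matrix r F * residue_matrix r G) $$ (i, k)"
    by (simp add: fps_eq_iff)
qed (simp_all add: residue_matrix_def)

lemma residue_matrix_1: "residue_matrix r 1 = 1\<^sub>m r"
  by (rule eq_matI) (auto simp: residue_matrix_def fps_eq_iff)

lemma det_residue_matrix_prod:
  "finite J \<Longrightarrow> det (residue_matrix r (\<Prod>j\<in>J. F j)) = (\<Prod>j\<in>J. det (residue_matrix r (F j)))"
  by (induction J rule: finite_induct)
    (simp_all add: residue_matrix_1 residue_matrix_mult det_mult[of _ r])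

text \<open>In the Leibniz sum only the permutation \<open>p = v\<close> survives; it exists exactly
  when the residues are distinct, and its sign is then the inversion sign in
  \<open>s_hat_tuple\<close>.\<close>

lemma permutation_of_residues:
  fixes w :: "nat list"
  assumes "0 < r" "length w = r"
  defines "v \<equiv> \<lambda>i. (w ! i + i) mod r"
  shows "(\<Sum>p | p permutes {0..<r}. of_int (sign p) * (if \<forall>i<r. v i = p i then 1 else 0))
    = (of_int (s_hat_tuple r w) :: 'a :: comm_ring_1)"
proof (cases "inj_on v {..<r}")
  case True
  \<comment> \<open>Extended by the identity beyond \<open>r\<close>, as \<open>permutes\<close>
    requires.\<close>
  define q where "q i = (if i < r then v i else i)" for i
  have "q ` {..<r} \<subseteq> {..<r}" using assms by (auto simp: q_def)
  moreover have inj: "inj_on q {..<r}" using True by (auto simp: inj_on_def q_def)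
  ultimately have "bij_betw q {..<r} {..<r}"
    by (simp add: bij_betw_def endo_inj_surj)
  then have q: "q permutes {..<r}"
    by (rule bij_imp_permutes) (simp add: q_def)
  have "(if \<forall>i<r. v i = p i then 1 else 0) = (if p = q then 1 else (0::'a))"
    if "p permutes {0..<r}" for p
    using that q by (auto simp: q_def fun_eq_iff permutes_def atLeast0LessThan)
  then have "(\<Sum>p | p permutes {0..<r}. of_int (sign p) * (if \<forall>i<r. v i = p i then 1 else 0))
      = (\<Sum>p | p permutes {0..<r}. if p = q then of_int (sign p) else (0::'a))"
    by (intro sum.cong) auto
  also have "\<dots> = of_int (sign q)"
    using q by (simp add: sum.delta finite_permutations atLeast0LessThan)
  also have "sign q = (-1) ^ card {(i, j). i < j \<and> j < r \<and> q i > q j}"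
    using q inj by (simp add: sign_eq_inversion_sign inversion_sign_card)
  also have "{(i, j). i < j \<and> j < r \<and> q i > q j} = {(i, j). i < j \<and> j < r \<and> v i > v j}"
    by (auto simp: q_def)
  also have "(-1) ^ card \<dots> = s_hat_tuple r w"
    using True unfolding s_hat_tuple_def v_def Let_def by simp
  finally show ?thesis .
next
  case False
  have "\<not> (\<forall>i<r. v i = p i)" if "p permutes {0..<r}" for p
    using False inj_on_subset[OF permutes_inj[OF that]]
    by (metis inj_on_cong lessThan_iff subset_UNIV)
  then have "(\<Sum>p | p permutes {0..<r}. of_int (sign p) * (if \<forall>i<r. v i = p i then 1 else 0)) = (0::'a)"
    by (intro sum.neutral ballI) (subst if_not_P, auto)
  moreover have "s_hat_tuple r w = 0"
    using False unfolding s_hat_tuple_def v_def Let_def by simp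
  ultimately show ?thesis by simp
qed

text \<open>A coefficient of a product of \<open>r\<close> series is a sum over the lists
  \<open>w\<close> of exponents with total \<open>n\<close>. The entry in row \<open>i\<close>,
  column \<open>p i\<close> keeps the exponent \<open>w ! i\<close> only if
  \<open>(w ! i + i) mod r = p i\<close>, so the sum over \<open>p\<close> can be carried out for
  each \<open>w\<close> separately.\<close>

lemma det_residue_matrix_nth:
  assumes "0 < r"
  shows "fps_nth (det (residue_matrix r F)) n
    = (\<Sum>w\<in>natpermute n r. of_int (s_hat_tuple r w) * (\<Prod>i<r. fps_nth F (w ! i)))"
proof -
  have fps_of_int: "(of_int z :: 'a fps) = fps_const (of_int z)" for z
    by (simp add: fps_of_int)
  have prod: "fps_nth (\<Prod>i=0..<r. residue_matrix r F $$ (i, p i)) n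
      = (\<Sum>w\<in>natpermute n r. (if \<forall>i<r. (w ! i + i) mod r = p i then 1 else 0) *
          (\<Prod>i<r. fps_nth F (w ! i)))" if p: "p permutes {0..<r}" for p
  proof -
    have pr: "p i < r" if "i < r" for i
      using permutes_in_image[OF p, of i] that by simp
    have "{0..r - 1} = {0..<r}" "r - 1 + 1 = r" using assms by auto
    then have "fps_nth (\<Prod>i=0..<r. residue_matrix r F $$ (i, p i)) n
        = (\<Sum>w\<in>natpermute n r. \<Prod>i=0..<r. fps_nth (residue_matrix r F $$ (i, p i)) (w ! i))"
      using fps_prod_nth[of "\<lambda>i. residue_matrix r F $$ (i, p i)" "r - 1" n] by simp
    also have "\<dots> = (\<Sum>w\<in>natpermute n r. \<Prod>i<r.
        (if (w ! i + i) mod r = p i then fps_nth F (w ! i) else 0))"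
      using pr by (intro sum.cong prod.cong) (auto simp: residue_matrix_def)
    also have "\<dots> = (\<Sum>w\<in>natpermute n r. (if \<forall>i<r. (w ! i + i) mod r = p i then 1 else 0) *
          (\<Prod>i<r. fps_nth F (w ! i)))"
    proof (intro sum.cong refl)
      fix w
      show "(\<Prod>i<r. (if (w ! i + i) mod r = p i then fps_nth F (w ! i) else 0))
        = (if \<forall>i<r. (w ! i + i) mod r = p i then 1 else 0) * (\<Prod>i<r. fps_nth F (w ! i))"
      proof (cases "\<forall>i<r. (w ! i + i) mod r = p i")
        case False
        then obtain i where "i < r" "(w ! i + i) mod r \<noteq> p i" by blast
        then have "(\<Prod>i<r. (if (w ! i + i) mod r = p i then fps_nth F (w ! i) else 0)) = 0"
          by (intro prod_zero) auto
        then show ?thesis by (subst if_not_P[OF False]) simp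
      qed simp
    qed
    finally show ?thesis .
  qed
  have "fps_nth (det (residue_matrix r F)) n
      = (\<Sum>p | p permutes {0..<r}. of_int (sign p) *
          fps_nth (\<Prod>i=0..<r. residue_matrix r F $$ (i, p i)) n)"
    by (simp add: det_def'[of _ r] fps_sum_nth fps_of_int del: of_int_of_nat_eq)
  also have "\<dots> = (\<Sum>p | p permutes {0..<r}. \<Sum>w\<in>natpermute n r. of_int (sign p) *
      (if \<forall>i<r. (w ! i + i) mod r = p i then 1 else 0) * (\<Prod>i<r. fps_nth F (w ! i)))"
    by (intro sum.cong) (simp_all add: prod sum_distrib_left mult.assoc)
  also have "\<dots> = (\<Sum>w\<in>natpermute n r. (\<Sum>p | p permutes {0..<r}. of_int (sign p) *
      (if \<forall>i<r. (w ! i + i) mod r = p i then 1 else 0)) * (\<Prod>i<r. fps_nth F (w ! i)))"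
    by (subst sum.swap) (simp add: sum_distrib_right)
  also have "\<dots> = (\<Sum>w\<in>natpermute n r. of_int (s_hat_tuple r w) * (\<Prod>i<r. fps_nth F (w ! i)))"
    by (intro sum.cong refl arg_cong2[of _ _ _ _ "(*)"] permutation_of_residues)
      (use assms in \<open>auto simp: natpermute_def\<close>)
  finally show ?thesis .
qed

section \<open>The determinant for a single linear factor\<close>

lemma s_hat_tuple_zeros: "s_hat_tuple r (replicate r 0) = 1"
proof -
  have v: "(replicate r 0 ! i + i) mod r = i" if "i < r" for i
    using that by simp
  have "{(i, j). i < j \<and> j < r
      \<and> (replicate r 0 ! i + i) mod r > (replicate r 0 ! j + j) mod r} = {}"
    by (auto simp: v)
  moreover have "inj_on (\<lambda>i. (replicate r 0 ! i + i) mod r) {..<r}"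
    by (rule inj_onI) (simp add: v)
  ultimately show ?thesis
    by (simp only: s_hat_tuple_def Let_def if_True card.empty power_0)
qed

text \<open>The residues are 1, ..., r-1, 0: the final 0 is inverted with each of the
  \<open>r - 1\<close> values before it, and there is no other inversion.\<close>

lemma s_hat_tuple_ones:
  assumes "0 < r"
  shows "s_hat_tuple r (replicate r 1) = (-1) ^ (r - 1)"
proof -
  let ?v = "\<lambda>i. (replicate r 1 ! i + i) mod r"
  have v: "?v i = (if Suc i = r then 0 else Suc i)" if "i < r" for i
    using that by simp
  have "{(i, j). i < j \<and> j < r \<and> ?v i > ?v j} = (\<lambda>i. (i, r - 1)) ` {..<r - 1}"
  proof (intro equalityI subsetI)
    fix x assume "x \<in> {(i, j). i < j \<and> j < r \<and> ?v i > ?v j}"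
    then obtain i j where "x = (i, j)" "i < j" "j < r" "?v i > ?v j" by auto
    then show "x \<in> (\<lambda>i. (i, r - 1)) ` {..<r - 1}"
      using v[of i] v[of j] by (cases "Suc j = r") auto
  next
    fix x assume "x \<in> (\<lambda>i. (i, r - 1)) ` {..<r - 1}"
    then obtain i where "x = (i, r - 1)" "i < r - 1" by auto
    then show "x \<in> {(i, j). i < j \<and> j < r \<and> ?v i > ?v j}"
      using v[of i] v[of "r - 1"] by auto
  qed
  then have "card {(i, j). i < j \<and> j < r \<and> ?v i > ?v j} = r - 1"
    by (simp add: card_image inj_on_def)
  moreover have "inj_on ?v {..<r}"
  proof (rule inj_onI)
    fix x y assume "x \<in> {..<r}" "y \<in> {..<r}" "?v x = ?v y"
    then show "x = y" using v[of x] v[of y] by (simp only: lessThan_iff split: if_splits)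
  qed
  ultimately show ?thesis
    unfolding s_hat_tuple_def Let_def by simp
qed

text \<open>If a 1 at position \<open>i\<close> is followed cyclically by a 0, both positions have
  residue \<open>i + 1\<close>. With distinct residues a 1 therefore propagates around the whole
  cycle, which leaves no place for a 0.\<close>

lemma s_hat_tuple_mixed:
  assumes "length w = r" "set w \<subseteq> {0, 1}" "0 \<in> set w" "1 \<in> set w"
  shows "s_hat_tuple r w = 0"
proof -
  let ?v = "\<lambda>i. (w ! i + i) mod r"
  have "\<not> inj_on ?v {..<r}"
  proof
    assume inj: "inj_on ?v {..<r}"
    have r: "0 < r" using assms by auto
    have step: "w ! (Suc i mod r) = 1" if "i < r" "w ! i = 1" for i
    proof (rule ccontr)
      assume "w ! (Suc i mod r) \<noteq> 1"
      then have 0: "w ! (Suc i mod r) = 0"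
        using assms r by (metis insert_iff mod_less_divisor nth_mem singletonD subset_iff)
      then have "?v (Suc i mod r) = ?v i" using that by simp
      then have "Suc i mod r = i" using inj_onD[OF inj, of "Suc i mod r" i] that r by simp
      with 0 that show False by simp
    qed
    obtain a where a: "a < r" "w ! a = 1" using assms by (metis in_set_conv_nth)
    have all: "w ! ((a + k) mod r) = 1" for k
    proof (induction k)
      case (Suc k)
      then show ?case using step[of "(a + k) mod r"] r by (simp add: mod_Suc_eq)
    qed (use a in simp)
    obtain b where b: "b < r" "w ! b = 0" using assms by (metis in_set_conv_nth)
    \<comment> \<open>The extra \<open>r\<close> keeps the number of steps from \<open>a\<close> to
      \<open>b\<close> a true difference when \<open>b < a\<close>.\<close>
    have "(a + (b + r - a)) mod r = b" using a b by simp
    with all[of "b + r - a"] b show False by simp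
  qed
  then show ?thesis unfolding s_hat_tuple_def Let_def by simp
qed

text \<open>This is the norm of 1 - yt down to series in t^r. Only exponents 0 and 1 occur, mixed
  tuples have sign 0, the zero tuple gives 1, and the tuple of ones gives (-1)^(r-1) (-y)^r = -y^r
  in degree \<open>r\<close>.\<close>

lemma det_residue_matrix_linear:
  fixes y :: "'a::comm_ring_1"
  assumes r: "0 < r"
  shows "det (residue_matrix r (1 - fps_const y * fps_X)) = 1 - fps_const (y ^ r) * fps_X ^ r"
proof (rule fps_ext)
  fix n
  let ?F = "1 - fps_const y * fps_X"
  define g where "g w = of_int (s_hat_tuple r w) * (\<Prod>i<r. fps_nth ?F (w ! i))" for w
  have F: "fps_nth ?F k = (if k = 0 then 1 else if k = 1 then -y else 0)" for k
    by simp
  have g_zero: "g w = 0" if w: "w \<in> natpermute n r" "w \<notin> {replicate r 0, replicate r 1}" for w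
  proof (cases "set w \<subseteq> {0, 1}")
    case True
    have len: "length w = r" using w by (simp add: natpermute_def)
    have "\<exists>x\<in>set w. x \<noteq> 1" "\<exists>x\<in>set w. x \<noteq> 0"
      using w(2) replicate_eqI[OF len, of 0] replicate_eqI[OF len, of 1] by blast+
    then have "0 \<in> set w" "1 \<in> set w" using True by auto
    then show ?thesis using s_hat_tuple_mixed[OF len True] by (simp add: g_def)
  next
    case False
    then obtain x where "x \<in> set w" "x \<notin> {0, 1}" by blast
    then obtain i where "i < r" "w ! i \<notin> {0, 1}"
      using w by (auto simp: natpermute_def in_set_conv_nth)
    then have "(\<Prod>i<r. fps_nth ?F (w ! i)) = 0"
      by (intro prod_zero) (auto simp: F)
    then show ?thesis by (simp add: g_def)
  qed
  have ne: "replicate r (0::nat) \<noteq> replicate r 1" using r by (cases r) auto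
  have "fps_nth (det (residue_matrix r ?F)) n = (\<Sum>w\<in>natpermute n r. g w)"
    unfolding det_residue_matrix_nth[OF r] g_def ..
  also have "\<dots> = (\<Sum>w\<in>natpermute n r \<inter> {replicate r 0, replicate r 1}. g w)"
    by (rule sum.mono_neutral_right) (use g_zero in \<open>auto simp: natpermute_finite\<close>)
  also have "\<dots> = (\<Sum>w\<in>{replicate r 0, replicate r 1}. if w \<in> natpermute n r then g w else 0)"
    by (subst sum.inter_restrict[symmetric]) (auto simp: Int_commute)
  also have "\<dots> = (if n = 0 then 1 else 0) + (if n = r then - (y ^ r) else 0)"
  proof -
    have "g (replicate r 0) = 1" using F by (simp add: g_def s_hat_tuple_zeros)
    moreover have "g (replicate r 1) = - (y ^ r)"
    proof -
      have "g (replicate r 1) = (-1) ^ (r - 1) * (- y) ^ r"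
        using r s_hat_tuple_ones[OF r] F by (simp add: g_def)
      also have "(- y) ^ r = (-1) ^ r * y ^ r" by (rule power_minus)
      also have "(-1) ^ (r - 1) * ((-1) ^ r * y ^ r) = (-1) ^ (r - 1 + r) * y ^ r"
        by (simp add: power_add mult.assoc)
      also have "(-1) ^ (r - 1 + r) = (-1 :: 'a)" using r by simp
      finally show ?thesis by simp
    qed
    ultimately show ?thesis
      using ne r by (auto simp: natpermute_def sum_list_replicate)
  qed
  also have "\<dots> = fps_nth (1 - fps_const (y ^ r) * fps_X ^ r) n"
    using r by (auto simp: fps_X_power_nth)
  finally show "fps_nth (det (residue_matrix r ?F)) n = fps_nth (1 - fps_const (y ^ r) * fps_X ^ r) n" .
qed

lemma prod_fps_const: "(\<Prod>v\<in>S. fps_const (f v)) = fps_const (\<Prod>v\<in>S. (f v :: 'a::comm_ring_1))"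
  by (induction S rule: infinite_finite_induct) simp_all

text \<open>Used twice: with general \<open>r\<close> for the determinant, and with
  \<open>r = 1\<close> for the series whose matrix is formed.\<close>

lemma fps_nth_prod_linear:
  fixes y :: "'v \<Rightarrow> 'a::comm_ring_1"
  assumes "finite V" "0 < r"
  shows "fps_nth (\<Prod>v\<in>V. 1 - fps_const (y v) * fps_X ^ r) (r * k)
    = (-1) ^ k * (\<Sum>S | S \<subseteq> V \<and> card S = k. \<Prod>v\<in>S. y v)"
proof -
  have "(\<Prod>v\<in>V. 1 - fps_const (y v) * fps_X ^ r)
      = (\<Prod>v\<in>V. fps_const (- y v) * fps_X ^ r + 1)"
    by (simp flip: fps_const_neg)
  also have "\<dots> = (\<Sum>S\<in>Pow V. fps_const (\<Prod>v\<in>S. - y v) * fps_X ^ (r * card S))"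
    using assms(1)
    by (simp add: prod_add prod.distrib power_mult prod_fps_const del: fps_const_neg)
  finally have "fps_nth (\<Prod>v\<in>V. 1 - fps_const (y v) * fps_X ^ r) (r * k)
      = (\<Sum>S\<in>Pow V. if card S = k then (\<Prod>v\<in>S. - y v) else 0)"
    using assms(2) by (auto simp: fps_sum_nth fps_X_power_nth intro!: sum.cong)
  also have "\<dots> = (\<Sum>S | S \<subseteq> V \<and> card S = k. \<Prod>v\<in>S. - y v)"
    using assms(1) by (intro sum.mono_neutral_cong_right) auto
  also have "\<dots> = (\<Sum>S | S \<subseteq> V \<and> card S = k. (-1) ^ k * (\<Prod>v\<in>S. y v))"
    by (intro sum.cong) (auto simp: prod_uminus)
  finally show ?thesis by (simp add: sum_distrib_left)
qed

text \<open>The coefficient of t^(rm) in the determinant is computed both from its factorization and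
  from its Leibniz expansion. The values \<open>y v\<close> lie in an arbitrary commutative ring, so
  that monomials of \<open>series\<close> can be inserted for them.\<close>

theorem elementary_of_powers:
  fixes y :: "'v \<Rightarrow> 'a::comm_ring_1"
  assumes V: "finite V" and r: "0 < r"
  defines "e \<equiv> \<lambda>z k. \<Sum>S | S \<subseteq> V \<and> card S = k. \<Prod>v\<in>S. (z v :: 'a)"
  shows "(-1) ^ m * e (\<lambda>v. y v ^ r) m
    = (\<Sum>w\<in>natpermute (r * m) r. of_int (s_hat_tuple r w) * (\<Prod>i<r. (-1) ^ (w ! i) * e y (w ! i)))"
proof -
  let ?F = "\<Prod>v\<in>V. 1 - fps_const (y v) * fps_X"
  have "det (residue_matrix r ?F) = (\<Prod>v\<in>V. 1 - fps_const (y v ^ r) * fps_X ^ r)"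
    by (simp add: det_residue_matrix_prod[OF V] det_residue_matrix_linear[OF r])
  then have "fps_nth (det (residue_matrix r ?F)) (r * m) = (-1) ^ m * e (\<lambda>v. y v ^ r) m"
    by (simp add: fps_nth_prod_linear[OF V r] e_def)
  moreover have "fps_nth ?F k = (-1) ^ k * e y k" for k
    using fps_nth_prod_linear[OF V, of 1 y k] by (simp add: e_def)
  ultimately show ?thesis
    by (simp add: det_residue_matrix_nth[OF r])
qed

section \<open>Elementary and complete homogeneous symmetric functions\<close>

abbreviation keys :: "monom \<Rightarrow> (nat \<times> nat) set" where "keys \<equiv> Poly_Mapping.keys"

abbreviation lookup :: "monom \<Rightarrow> nat \<times> nat \<Rightarrow> nat" where "lookup \<equiv> Poly_Mapping.lookup"

lemma coeff_arith [simp]: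
  "coeff 0 m = 0" "coeff 1 m = (if m = 0 then 1 else 0)"
  "coeff (f + g) m = coeff f m + coeff g m" "coeff (f - g) m = coeff f m - coeff g m"
  "coeff (- f) m = - coeff f m" "coeff (scale c f) m = c * coeff f m"
  by (transfer; simp)+

lemma coeff_mult: "coeff (f * g) m = (\<Sum>(a, b) | a + b = m. coeff f a * coeff g b)"
  unfolding times_series.rep_eq ..

lemma coeff_sum [simp]: "coeff (sum f A) m = (\<Sum>x\<in>A. coeff (f x) m)"
  by (induction A rule: infinite_finite_induct) simp_all

text \<open>Signs enter as ring multiples, from determinants and expansions, whereas spans and
  \<open>representation\<close> speak of \<open>scale\<close>.\<close>

lemma of_int_mult_eq_scale: "of_int z * f = scale (of_int z) f"
proof (induction z rule: int_induct[of _ 0])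
  case base
  show ?case by (simp add: series_eqI)
next
  case (step1 z)
  have "of_int (z + 1) * f = of_int z * f + f" by (simp add: distrib_right)
  then show ?case by (intro series_eqI) (simp add: step1 distrib_right)
next
  case (step2 z)
  have "of_int (z - 1) * f = of_int z * f - f" by (simp add: left_diff_distrib)
  then show ?case by (intro series_eqI) (simp add: step2 left_diff_distrib)
qed

lemma keys_add_nat: "keys (a + b) = keys a \<union> keys b"
  by (auto simp: in_keys_iff lookup_add)

text \<open>The substitution of 0 for all variables outside \<open>V\<close>, a ring
  homomorphism.\<close>

definition restrict_vars :: "(nat \<times> nat) set \<Rightarrow> series \<Rightarrow> series" where
  "restrict_vars V f = Series (\<lambda>m. if keys m \<subseteq> V then coeff f m else 0)"

lemma restrict_vars_1 [simp]: "restrict_vars V 1 = 1"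
  by (rule series_eqI) (auto simp: restrict_vars_def)

text \<open>Exponents are natural numbers and cannot cancel, so a product of monomials stays within
  \<open>V\<close> exactly when both factors do.\<close>

lemma restrict_vars_mult: "restrict_vars V (f * g) = restrict_vars V f * restrict_vars V g"
proof (rule series_eqI)
  fix m
  have "coeff (restrict_vars V f * restrict_vars V g) m
      = (\<Sum>(a, b) | a + b = m. if keys m \<subseteq> V then coeff f a * coeff g b else 0)"
    unfolding coeff_mult by (intro sum.cong) (auto simp: restrict_vars_def keys_add_nat)
  then show "coeff (restrict_vars V (f * g)) m = coeff (restrict_vars V f * restrict_vars V g) m"
    by (simp add: restrict_vars_def coeff_mult)
qed

lemma restrict_vars_sum: "restrict_vars V (sum f A) = (\<Sum>x\<in>A. restrict_vars V (f x))"
  by (rule series_eqI) (simp add: restrict_vars_def)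

lemma restrict_vars_prod: "restrict_vars V (prod f A) = (\<Prod>x\<in>A. restrict_vars V (f x))"
  by (induction A rule: infinite_finite_induct) (simp_all add: restrict_vars_mult)

lemma restrict_vars_of_int_mult: "restrict_vars V (of_int z * f) = of_int z * restrict_vars V f"
  by (rule series_eqI) (simp add: restrict_vars_def of_int_mult_eq_scale)

text \<open>The coefficient of a monomial \<open>m\<close> is already visible for
  \<open>V = keys m\<close>.\<close>

lemma series_eq_restrict_varsI:
  assumes "\<And>V. finite V \<Longrightarrow> restrict_vars V f = restrict_vars V g"
  shows "f = g"
proof (rule series_eqI)
  fix m
  show "coeff f m = coeff g m"
    using arg_cong[OF assms[of "keys m"], of "\<lambda>h. coeff h m"] by (simp add: restrict_vars_def)
qed

definition monomial :: "monom \<Rightarrow> series" where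
  "monomial M = Series (\<lambda>m. if m = M then 1 else 0)"

lemma monomial_0 [simp]: "monomial 0 = 1"
  by (rule series_eqI) (simp add: monomial_def)

lemma monomial_add: "monomial (a + b) = monomial a * monomial b"
proof (rule series_eqI)
  fix m
  have "coeff (monomial a * monomial b) m
      = (\<Sum>x | fst x + snd x = m. if x = (a, b) then 1 else 0)"
    unfolding coeff_mult by (intro sum.cong) (auto simp: monomial_def split: if_splits)
  also have "\<dots> = (if m = a + b then 1 else 0)"
    using finite_splittings[of m] by (simp add: sum.delta case_prod_unfold)
  finally show "coeff (monomial (a + b)) m = coeff (monomial a * monomial b) m"
    by (simp add: monomial_def)
qed

lemma monomial_sum: "monomial (sum f S) = (\<Prod>v\<in>S. monomial (f v))"
  by (induction S rule: infinite_finite_induct) (simp_all add: monomial_add)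

lemma monomial_single_power:
  "monomial (Poly_Mapping.single v 1) ^ r = monomial (Poly_Mapping.single v r)"
proof (induction r)
  case (Suc r)
  then show ?case
    by (simp flip: monomial_add single_add)
qed simp

definition constant_monom :: "nat \<Rightarrow> (nat \<times> nat) set \<Rightarrow> monom" where
  "constant_monom r S = (\<Sum>v\<in>S. Poly_Mapping.single v r)"

lemma lookup_constant_monom:
  "finite S \<Longrightarrow> lookup (constant_monom r S) v = (if v \<in> S then r else 0)"
  by (simp add: constant_monom_def lookup_sum lookup_single when_def)

lemma keys_constant_monom: "finite S \<Longrightarrow> 0 < r \<Longrightarrow> keys (constant_monom r S) = S"
  by (auto simp: in_keys_iff lookup_constant_monom split: if_splits)

lemma eq_constant_monom_iff:
  assumes "finite S" "0 < r"
  shows "m = constant_monom r S \<longleftrightarrow> S = keys m \<and> (\<forall>v\<in>keys m. lookup m v = r)"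
proof
  assume "m = constant_monom r S"
  then show "S = keys m \<and> (\<forall>v\<in>keys m. lookup m v = r)"
    using assms by (simp add: keys_constant_monom lookup_constant_monom)
next
  assume S: "S = keys m \<and> (\<forall>v\<in>keys m. lookup m v = r)"
  show "m = constant_monom r S"
    by (rule poly_mapping_eqI) (use assms S in \<open>auto simp: lookup_constant_monom in_keys_iff\<close>)
qed

text \<open>The elementary symmetric function of degree \<open>k\<close> in \<open>x\<^sub>i\<^sub>1\<^sup>r, x\<^sub>i\<^sub>2\<^sup>r, \<dots>\<close>, for fixed \<open>i\<close>.\<close>

definition elementary :: "nat \<Rightarrow> nat \<Rightarrow> nat \<Rightarrow> series" where
  "elementary i r k = Series (\<lambda>m. if keys m \<subseteq> {i} \<times> {1..} \<and> (\<forall>v\<in>keys m. lookup m v = r)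
     \<and> card (keys m) = k then 1 else 0)"

lemma restrict_vars_elementary:
  assumes "finite V" "0 < r"
  shows "restrict_vars V (elementary i r k)
    = (\<Sum>S | S \<subseteq> V \<inter> {i} \<times> {1..} \<and> card S = k. \<Prod>v\<in>S. monomial (Poly_Mapping.single v 1) ^ r)"
proof (rule series_eqI)
  fix m
  let ?A = "{S. S \<subseteq> V \<inter> {i} \<times> {1..} \<and> card S = k}"
  have fin: "finite S" if "S \<in> ?A" for S
    using that assms finite_subset[of S V] by auto
  have "(\<Prod>v\<in>S. monomial (Poly_Mapping.single v 1) ^ r) = monomial (constant_monom r S)" for S
    unfolding monomial_single_power constant_monom_def by (rule monomial_sum[symmetric])
  then have "coeff (\<Sum>S\<in>?A. \<Prod>v\<in>S. monomial (Poly_Mapping.single v 1) ^ r) m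
      = (\<Sum>S\<in>?A. if m = constant_monom r S then 1 else 0)"
    unfolding coeff_sum by (simp only: monomial_def coeff_Series)
  also have "\<dots> = (\<Sum>S\<in>?A. if S = keys m then (if \<forall>v\<in>keys m. lookup m v = r then 1 else 0) else 0)"
  proof (rule sum.cong[OF refl])
    fix S assume "S \<in> ?A"
    note iff = eq_constant_monom_iff[OF fin[OF this] assms(2)]
    show "(if m = constant_monom r S then 1 else 0)
        = (if S = keys m then (if \<forall>v\<in>keys m. lookup m v = r then 1 else 0) else 0)"
      unfolding iff by simp
  qed
  also have "\<dots> = coeff (restrict_vars V (elementary i r k)) m"
    using assms by (subst sum.delta) (auto simp: restrict_vars_def elementary_def)
  finally show "coeff (restrict_vars V (elementary i r k)) m
      = coeff (\<Sum>S\<in>?A. \<Prod>v\<in>S. monomial (Poly_Mapping.single v 1) ^ r) m" ..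
qed

text \<open>The coefficient of t^k in the product of all factors 1 - x_ij t, for the fixed row
  \<open>i\<close>.\<close>

definition signed_elementary :: "nat \<Rightarrow> nat \<Rightarrow> series" where
  "signed_elementary i k = of_int ((-1) ^ k) * elementary i 1 k"

lemma elementary_expansion:
  assumes r: "0 < r"
  shows "of_int ((-1) ^ k) * elementary i r k
    = (\<Sum>w\<in>natpermute (r * k) r. of_int (s_hat_tuple r w) * (\<Prod>j<r. signed_elementary i (w ! j)))"
proof (rule series_eq_restrict_varsI)
  fix V :: "(nat \<times> nat) set" assume V: "finite V"
  then have V': "finite (V \<inter> {i} \<times> {1..})" by simp
  define y :: "nat \<times> nat \<Rightarrow> series" where "y v = monomial (Poly_Mapping.single v 1)" for v
  have sign: "of_int ((-1) ^ l) * f = (-1) ^ l * f" for l and f :: series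
    by simp
  have e: "restrict_vars V (elementary i 1 l)
      = (\<Sum>S | S \<subseteq> V \<inter> {i} \<times> {1..} \<and> card S = l. \<Prod>v\<in>S. y v)" for l
    using restrict_vars_elementary[OF V, of 1 i l] unfolding y_def by (simp only: power_one_right zero_less_one)
  show "restrict_vars V (of_int ((-1) ^ k) * elementary i r k)
    = restrict_vars V (\<Sum>w\<in>natpermute (r * k) r.
        of_int (s_hat_tuple r w) * (\<Prod>j<r. signed_elementary i (w ! j)))"
    unfolding signed_elementary_def restrict_vars_sum restrict_vars_of_int_mult restrict_vars_prod
    unfolding restrict_vars_of_int_mult
    unfolding restrict_vars_elementary[OF V r] e
    unfolding sign y_def[symmetric]
    by (rule elementary_of_powers[OF V' r])
qed

lemma signed_elementary_0 [simp]: "signed_elementary i 0 = 1"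
  by (rule series_eqI) (auto simp: signed_elementary_def elementary_def)

lemma sum_lookup_eq_0_iff: "(\<Sum>v\<in>keys m. lookup m v) = 0 \<longleftrightarrow> m = 0"
proof -
  have "(\<Sum>v\<in>keys m. lookup m v) = 0 \<longleftrightarrow> (\<forall>v\<in>keys m. lookup m v = 0)" by simp
  also have "\<dots> \<longleftrightarrow> keys m = {}" by (metis all_not_in_conv in_keys_iff)
  finally show ?thesis by simp
qed

lemma complete_h_0 [simp]: "complete_h i 0 = 1"
  by (rule series_eqI) (auto simp: complete_h_def sum_lookup_eq_0_iff)

lemma sum_lookup_keys_superset:
  assumes "finite A" "keys m \<subseteq> A"
  shows "(\<Sum>v\<in>keys m. lookup m v) = (\<Sum>v\<in>A. lookup m v)"
  using assms by (intro sum.mono_neutral_left) (auto simp: in_keys_iff)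

text \<open>The identity E(-t) H(t) = 1 in positive degree. The splittings of a monomial
  \<open>m\<close> with square-free first factor correspond to the subsets of \<open>keys m\<close>,
  and their signs sum to (1 - 1)^|keys m|.\<close>

lemma signed_elementary_complete:
  assumes "0 < n"
  shows "(\<Sum>k\<le>n. signed_elementary i k * complete_h i (n - k)) = 0"
proof (rule series_eqI)
  fix m
  let ?X = "{i} \<times> {1..} :: (nat \<times> nat) set"
  let ?sq = "\<lambda>a. \<forall>v\<in>keys a. lookup a v = 1"
  define total where "total a = (\<Sum>v\<in>keys a. lookup a v)" for a :: monom
  have total_add: "total (a + b) = total a + total b" for a b
    unfolding total_def
    by (simp add: sum_lookup_keys_superset[of "keys a \<union> keys b"] keys_add_nat lookup_add sum.distrib)
  have total_sq: "total a = card (keys a)" if "?sq a" for a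
    using that by (simp add: total_def)
  have f: "coeff (signed_elementary i k) a
      = (if keys a \<subseteq> ?X \<and> ?sq a \<and> card (keys a) = k then (-1) ^ k else 0)" for k a
    unfolding signed_elementary_def of_int_mult_eq_scale by (simp add: elementary_def)
  have "coeff (\<Sum>k\<le>n. signed_elementary i k * complete_h i (n - k)) m
      = (\<Sum>(a, b) | a + b = m. \<Sum>k\<le>n. coeff (signed_elementary i k) a * coeff (complete_h i (n - k)) b)"
    by (simp add: coeff_mult sum.swap[of _ "{..n}"] case_prod_unfold)
  also have "\<dots> = (\<Sum>(a, b) | a + b = m.
      if keys m \<subseteq> ?X \<and> total m = n \<and> ?sq a then (-1) ^ card (keys a) else 0)"
  proof (rule sum.cong, simp, clarify)
    fix a b assume m: "m = a + b"
    have "(\<Sum>k\<le>n. coeff (signed_elementary i k) a * coeff (complete_h i (n - k)) b)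
        = (\<Sum>k\<le>n. if k = card (keys a) then
            (if keys m \<subseteq> ?X \<and> total b = n - k \<and> ?sq a then (-1) ^ k else 0) else 0)"
      unfolding f by (intro sum.cong) (auto simp: complete_h_def total_def m keys_add_nat)
    also have "\<dots> = (if keys m \<subseteq> ?X \<and> total m = n \<and> ?sq a then (-1) ^ card (keys a) else 0)"
      using total_sq[of a] by (cases "?sq a") (auto simp: m total_add sum.delta')
    finally show "(\<Sum>k\<le>n. coeff (signed_elementary i k) a * coeff (complete_h i (n - k)) b)
        = (if keys (a + b) \<subseteq> ?X \<and> total (a + b) = n \<and> ?sq a then (-1) ^ card (keys a) else 0)"
      by (simp add: m)
  qed
  also have "\<dots> = 0"
  proof (cases "keys m \<subseteq> ?X \<and> total m = n")
    case True
    \<comment> \<open>Positive degree enters here: over the empty set of variables the alternating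
      sum would be 1.\<close>
    then have ne: "keys m \<noteq> {}" using assms by (auto simp: total_def)
    have "(\<Sum>(a, b) | a + b = m.
          if keys m \<subseteq> ?X \<and> total m = n \<and> ?sq a then (-1) ^ card (keys a) else 0)
        = (\<Sum>(a, b) | a + b = m \<and> ?sq a. (-1) ^ card (keys a) :: rat)"
      using True finite_splittings[of m]
      by (intro sum.mono_neutral_cong_right) (auto simp: case_prod_unfold)
    \<comment> \<open>A square-free factor \<open>a\<close> is determined by its support, and the
      cofactor is then \<open>m - a\<close>.\<close>
    also have "\<dots> = (\<Sum>S\<in>Pow (keys m). (-1) ^ card S)"
    proof (rule sum.reindex_bij_witness
        [where j = "\<lambda>(a, b). keys a" and i = "\<lambda>S. (constant_monom 1 S, m - constant_monom 1 S)"])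
      fix S assume "S \<in> Pow (keys m)"
      then have S: "S \<subseteq> keys m" "finite S" using finite_subset[OF _ finite_keys] by auto
      have "constant_monom 1 S + (m - constant_monom 1 S) = m"
        by (rule poly_mapping_eqI)
          (use S in \<open>auto simp: lookup_add lookup_minus lookup_constant_monom in_keys_iff\<close>)
      then show "(constant_monom 1 S, m - constant_monom 1 S) \<in> {(a, b). a + b = m \<and> ?sq a}"
        using S by (simp add: keys_constant_monom lookup_constant_monom)
      show "(case (constant_monom 1 S, m - constant_monom 1 S) of (a, b) \<Rightarrow> keys a) = S"
        using S by (simp add: keys_constant_monom)
    next
      fix x assume "x \<in> {(a, b). a + b = m \<and> ?sq a}"
      then obtain a b where x: "x = (a, b)" "m = a + b" "?sq a" by auto
      have "constant_monom 1 (keys a) = a"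
        using eq_constant_monom_iff[of "keys a" 1 a] x by simp
      then show "(constant_monom 1 (case x of (a, b) \<Rightarrow> keys a),
          m - constant_monom 1 (case x of (a, b) \<Rightarrow> keys a)) = x"
        by (simp add: x)
      show "(case x of (a, b) \<Rightarrow> keys a) \<in> Pow (keys m)"
        by (simp add: x keys_add_nat)
      show "(-1) ^ card (case x of (a, b) \<Rightarrow> keys a) = (case x of (a, b) \<Rightarrow> (-1 :: rat) ^ card (keys a))"
        by (simp add: x)
    qed
    also have "\<dots> = (\<Prod>v\<in>keys m. (-1) + 1)"
      by (subst prod_add) simp_all
    also have "\<dots> = 0"
    proof (rule prod_zero[OF finite_keys])
      show "\<exists>v\<in>keys m. -1 + 1 = (0 :: rat)" using ne by (metis add.left_inverse all_not_in_conv)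
    qed
    finally show ?thesis .
  next
    case False
    then show ?thesis by (intro sum.neutral) (simp only: case_prod_unfold if_False simp_thms, auto)
  qed
  finally show "coeff (\<Sum>k\<le>n. signed_elementary i k * complete_h i (n - k)) m = coeff 0 m"
    by simp
qed

definition compositions :: "nat \<Rightarrow> nat list set" where
  "compositions n = {\<beta>. composition \<beta> \<and> sum_list \<beta> = n}"

lemma length_le_sum_list: "composition \<beta> \<Longrightarrow> length \<beta> \<le> sum_list \<beta>"
  by (induction \<beta>) (auto simp: composition_def)

lemma finite_compositions [simp]: "finite (compositions n)"
proof (rule finite_subset)
  show "compositions n \<subseteq> {\<beta>. set \<beta> \<subseteq> {..n} \<and> length \<beta> \<le> n}"
    using length_le_sum_list member_le_sum_list by (fastforce simp: compositions_def)
qed (rule finite_lists_length_le, simp)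

lemma compositions_0 [simp]: "compositions 0 = {[]}"
  by (auto simp: compositions_def composition_def) (metis list.set_intros(1) neq_Nil_conv not_less_zero)

abbreviation h_list :: "nat \<Rightarrow> nat list \<Rightarrow> series" where
  "h_list i \<beta> \<equiv> \<Prod>b\<leftarrow>\<beta>. complete_h i b"

text \<open>Solving \<open>signed_elementary_complete\<close> for its top term gives a recursion;
  the index of the complete factor becomes the leading part of a composition.\<close>

lemma signed_elementary_eq_compositions:
  "signed_elementary i n = (\<Sum>\<beta>\<in>compositions n. of_int ((-1) ^ length \<beta>) * h_list i \<beta>)"
proof (induction n rule: less_induct)
  case (less n)
  define c where "c \<beta> = of_int ((-1) ^ length \<beta>) * h_list i \<beta>" for \<beta>
  show ?case
  proof (cases "n = 0")
    case False
    have "(\<Sum>k\<le>n. signed_elementary i k * complete_h i (n - k)) = 0"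
      using False by (intro signed_elementary_complete) simp
    then have "signed_elementary i n = - (\<Sum>k<n. signed_elementary i k * complete_h i (n - k))"
      by (simp add: lessThan_Suc_atMost[symmetric] eq_neg_iff_add_eq_0 add.commute)
    \<comment> \<open>The minus sign is absorbed by the length, which grows by one with the new part
      \<open>n - k\<close>.\<close>
    also have "\<dots> = (\<Sum>k<n. \<Sum>\<beta>\<in>compositions k. c ((n - k) # \<beta>))"
      using less by (simp add: c_def sum_distrib_left sum_distrib_right sum_negf[symmetric] mult_ac)
    also have "\<dots> = (\<Sum>(k, \<beta>)\<in>Sigma {..<n} compositions. c ((n - k) # \<beta>))"
      by (subst sum.Sigma) simp_all
    also have "\<dots> = (\<Sum>\<beta>\<in>compositions n. c \<beta>)"
    proof (rule sum.reindex_bij_witness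
        [where j = "\<lambda>(k, \<beta>). (n - k) # \<beta>" and i = "\<lambda>\<beta>. (n - hd \<beta>, tl \<beta>)"])
      fix \<beta> assume \<beta>: "\<beta> \<in> compositions n"
      then obtain b \<beta>' where b: "\<beta> = b # \<beta>'"
        using False by (cases \<beta>) (auto simp: compositions_def)
      show "(case (n - hd \<beta>, tl \<beta>) of (k, \<beta>) \<Rightarrow> (n - k) # \<beta>) = \<beta>"
        "(n - hd \<beta>, tl \<beta>) \<in> Sigma {..<n} compositions"
        using \<beta> by (auto simp: b compositions_def composition_def)
    qed (auto simp: compositions_def composition_def)
    finally show ?thesis by (simp add: c_def)
  qed simp
qed

section \<open>Labeled compositions\<close>

text \<open>Distributivity over a list of factors. Choices are recorded by \<open>list_all2\<close>,
  the form in which \<open>tabloids\<close> are defined; the compositions chosen for the parts of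
  \<open>\<delta>\<close> are handled in the same way.\<close>

lemma prod_list_sum_list_all2:
  fixes g :: "'a \<Rightarrow> 'b \<Rightarrow> 'c :: comm_semiring_1"
  assumes "\<And>x. x \<in> set xs \<Longrightarrow> finite (A x)"
  shows "finite {ys. list_all2 (\<lambda>y x. y \<in> A x) ys xs}
    \<and> (\<Prod>x\<leftarrow>xs. \<Sum>y\<in>A x. g x y) = (\<Sum>ys | list_all2 (\<lambda>y x. y \<in> A x) ys xs. \<Prod>(x, y)\<leftarrow>zip xs ys. g x y)"
  using assms
proof (induction xs)
  case (Cons x xs)
  let ?L = "\<lambda>xs. {ys. list_all2 (\<lambda>y x. y \<in> A x) ys xs}"
  have eq: "?L (x # xs) = (\<lambda>(y, ys). y # ys) ` (A x \<times> ?L xs)"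
    by (auto simp: list_all2_Cons2)
  have inj: "inj_on (\<lambda>(y, ys). y # ys) (A x \<times> ?L xs)"
    by (auto intro: inj_onI)
  have fin: "finite (A x)" "finite (?L xs)" using Cons by auto
  have "(\<Sum>ys\<in>?L (x # xs). \<Prod>(x, y)\<leftarrow>zip (x # xs) ys. g x y)
      = (\<Sum>(y, ys)\<in>A x \<times> ?L xs. g x y * (\<Prod>(x, y)\<leftarrow>zip xs ys. g x y))"
    unfolding eq by (subst sum.reindex[OF inj]) (simp add: case_prod_unfold)
  also have "\<dots> = (\<Sum>y\<in>A x. g x y) * (\<Sum>ys\<in>?L xs. \<Prod>(x, y)\<leftarrow>zip xs ys. g x y)"
    by (simp add: sum_product sum.cartesian_product)
  finally show ?case
    using Cons fin unfolding eq by simp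
qed simp

section \<open>Labelings as divisions of a list into consecutive blocks\<close>

fun block_labels :: "nat \<Rightarrow> 'a list list \<Rightarrow> nat list" where
  "block_labels k [] = []"
| "block_labels k (B # Bs) = replicate (length B) k @ block_labels (Suc k) Bs"

text \<open>The inverse passage: the block that received the label \<open>j\<close>.\<close>

definition labeled_part :: "'a list \<Rightarrow> nat list \<Rightarrow> nat \<Rightarrow> 'a list" where
  "labeled_part \<gamma> L j = map fst (filter (\<lambda>(a, l). l = j) (zip \<gamma> L))"

lemma length_block_labels [simp]: "length (block_labels k Bs) = length (concat Bs)"
  by (induction k Bs rule: block_labels.induct) simp_all

lemma set_block_labels:
  "[] \<notin> set Bs \<Longrightarrow> set (block_labels k Bs) = {k..<k + length Bs}"
  by (induction k Bs rule: block_labels.induct) (auto simp: set_replicate_conv_if)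

lemma labeled_part_append:
  "length \<gamma> = length L \<Longrightarrow> labeled_part (\<gamma> @ \<gamma>') (L @ L') j = labeled_part \<gamma> L j @ labeled_part \<gamma>' L' j"
  by (simp add: labeled_part_def)

lemma labeled_part_replicate:
  "labeled_part B (replicate (length B) k) j = (if j = k then B else [])"
  by (induction B) (auto simp: labeled_part_def)

lemma labeled_part_block_labels:
  "labeled_part (concat Bs) (block_labels k Bs) j
    = (if k \<le> j \<and> j < k + length Bs then Bs ! (j - k) else [])"
proof (induction k Bs rule: block_labels.induct)
  case (2 k B Bs)
  then show ?case
    by (auto simp: labeled_part_append labeled_part_replicate nth_Cons' Suc_diff_Suc)
qed (auto simp: labeled_part_def)

lemma map_labeled_part_block_labels:
  "map (labeled_part (concat Bs) (block_labels k Bs)) [k..<k + length Bs] = Bs"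
  by (rule nth_equalityI) (simp_all add: labeled_part_block_labels)

lemma sum_list_labeled_part:
  "length \<gamma> = length L \<Longrightarrow>
    sum_list (labeled_part \<gamma> L j) = (\<Sum>p | p < length L \<and> L ! p = j. (\<gamma> ! p :: nat))"
proof (induction \<gamma> L rule: list_induct2)
  case (Cons a \<gamma> l L)
  have "{p. p < length (l # L) \<and> (l # L) ! p = j}
      = (if l = j then {0} else {}) \<union> Suc ` {p. p < length L \<and> L ! p = j}"
  proof (rule Set.set_eqI)
    fix p
    show "p \<in> {p. p < length (l # L) \<and> (l # L) ! p = j}
        \<longleftrightarrow> p \<in> (if l = j then {0} else {}) \<union> Suc ` {p. p < length L \<and> L ! p = j}"
      by (cases p) auto
  qed
  then have "(\<Sum>p | p < length (l # L) \<and> (l # L) ! p = j. (a # \<gamma>) ! p)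
      = (\<Sum>p\<in>(if l = j then {0} else {}). (a # \<gamma>) ! p) + (\<Sum>p | p < length L \<and> L ! p = j. \<gamma> ! p)"
    by (simp only:) (subst sum.union_disjoint, auto simp: sum.reindex)
  with Cons show ?case by (simp add: labeled_part_def)
qed (simp add: labeled_part_def)

text \<open>The conditions of \<open>labeling\<close> on neighbouring labels only. The starting
  label is left free, so that tails of a labeling satisfy the predicate as well.\<close>

definition unit_steps :: "nat list \<Rightarrow> bool" where
  "unit_steps = successively (\<lambda>x y. x \<le> y \<and> y \<le> x + 1)"

lemma labeling_iff:
  "labeling r L \<longleftrightarrow> set L \<subseteq> {1..r} \<and> (L \<noteq> [] \<longrightarrow> hd L = 1) \<and> unit_steps L"
  unfolding labeling_def unit_steps_def successively_conv_nth sorted_iff_nth_Suc by auto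

lemma hd_block_labels: "[] \<notin> set Bs \<Longrightarrow> Bs \<noteq> [] \<Longrightarrow> hd (block_labels k Bs) = k"
  by (cases Bs) (auto simp: hd_append hd_replicate)

lemma unit_steps_replicate: "unit_steps (replicate n k)"
  by (induction n) (auto simp: unit_steps_def successively_Cons hd_replicate)

lemma unit_steps_block_labels: "[] \<notin> set Bs \<Longrightarrow> unit_steps (block_labels k Bs)"
proof (induction k Bs rule: block_labels.induct)
  case (2 k B Bs)
  then show ?case
    using unit_steps_replicate[of "length B" k] hd_block_labels[of Bs "Suc k"]
    by (cases "Bs = []") (auto simp: unit_steps_def successively_append_iff)
qed (simp add: unit_steps_def)

text \<open>The labels after the head begin either with the same value, and then the head joins the
  first block of the tail, or with the next value, and then it forms a block of its own. The start
  \<open>k\<close> is arbitrary because it changes in the second case.\<close>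

lemma ex_block_labels:
  assumes "length \<gamma> = length L" "unit_steps L" "L \<noteq> [] \<Longrightarrow> hd L = k"
  shows "\<exists>Bs. [] \<notin> set Bs \<and> concat Bs = \<gamma> \<and> block_labels k Bs = L"
  using assms
proof (induction \<gamma> L arbitrary: k rule: list_induct2)
  case Nil
  show ?case by (rule exI[of _ "[]"]) simp
next
  case (Cons a \<gamma> l L)
  have l: "l = k" using Cons.prems by simp
  have steps: "unit_steps L" using Cons.prems by (auto simp: unit_steps_def successively_Cons)
  have "L = [] \<or> hd L = k \<or> hd L = Suc k"
    using Cons.prems l by (auto simp: unit_steps_def successively_Cons le_Suc_eq)
  then consider "L = []" | "L \<noteq> []" "hd L = k" | "L \<noteq> []" "hd L = Suc k"
    by blast
  then show ?case
  proof cases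
    case 1
    then show ?thesis using Cons.hyps l by (intro exI[of _ "[[a]]"]) auto
  next
    case 2
    then obtain Bs where Bs: "[] \<notin> set Bs" "concat Bs = \<gamma>" "block_labels k Bs = L"
      using Cons.IH[OF steps] by blast
    with 2 obtain B Bs' where "Bs = B # Bs'" by (cases Bs) auto
    then show ?thesis using Bs l by (intro exI[of _ "(a # B) # Bs'"]) auto
  next
    case 3
    then obtain Bs where "[] \<notin> set Bs" "concat Bs = \<gamma>" "block_labels (Suc k) Bs = L"
      using Cons.IH[OF steps] by blast
    then show ?thesis using l by (intro exI[of _ "[a] # Bs"]) auto
  qed
qed

definition labeled_compositions :: "nat \<Rightarrow> nat \<Rightarrow> (nat list \<times> nat list) set" where
  "labeled_compositions r n
    = {(\<gamma>, L). \<gamma> \<in> compositions n \<and> length L = length \<gamma> \<and> labeling r L}"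

text \<open>One component of \<open>label_type\<close>, with the number of boxes divided by the
  height replaced by the part of \<open>\<gamma>\<close> that it stands for.\<close>

definition merge_labels :: "nat list \<Rightarrow> nat list \<Rightarrow> nat list" where
  "merge_labels \<gamma> L = map (\<lambda>j. \<Sum>p | p < length L \<and> L ! p = j. \<gamma> ! p) [1..<Suc (card (set L))]"

lemma merge_labels_block_labels:
  assumes "[] \<notin> set Bs"
  shows "merge_labels (concat Bs) (block_labels 1 Bs) = map sum_list Bs"
proof -
  have "card (set (block_labels 1 Bs)) = length Bs"
    by (simp add: set_block_labels[OF assms])
  then have "merge_labels (concat Bs) (block_labels 1 Bs)
      = map sum_list (map (labeled_part (concat Bs) (block_labels 1 Bs)) [1..<1 + length Bs])"
    by (simp add: merge_labels_def sum_list_labeled_part)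
  then show ?thesis by (simp only: map_labeled_part_block_labels)
qed

text \<open>An empty block would skip a label, and more than \<open>r\<close> blocks would exhaust
  the labels.\<close>

definition composition_lists :: "nat \<Rightarrow> nat \<Rightarrow> nat list list set" where
  "composition_lists r n = {Bs. [] \<notin> set Bs \<and> length Bs \<le> r \<and> concat Bs \<in> compositions n}"

text \<open>Injectivity: the set of labels reveals the number of blocks, after which
  \<open>labeled_part\<close> recovers each of them. Surjectivity is
  \<open>ex_block_labels\<close>.\<close>

lemma bij_betw_block_labels:
  "bij_betw (\<lambda>Bs. (concat Bs, block_labels 1 Bs)) (composition_lists r n) (labeled_compositions r n)"
proof (rule bij_betw_imageI)
  show "inj_on (\<lambda>Bs. (concat Bs, block_labels 1 Bs)) (composition_lists r n)"
  proof (rule inj_onI, clarify)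
    fix Bs Bs' :: "nat list list"
    assume "Bs \<in> composition_lists r n" "Bs' \<in> composition_lists r n"
      and eq: "concat Bs = concat Bs'" "block_labels 1 Bs = block_labels 1 Bs'"
    then have "length Bs = length Bs'"
      using arg_cong[OF set_block_labels[of Bs 1], of card] arg_cong[OF set_block_labels[of Bs' 1], of card]
      by (simp add: composition_lists_def)
    then show "Bs = Bs'"
      using map_labeled_part_block_labels[of Bs 1] map_labeled_part_block_labels[of Bs' 1] eq
      by metis
  qed
  show "(\<lambda>Bs. (concat Bs, block_labels 1 Bs)) ` composition_lists r n = labeled_compositions r n"
  proof (intro equalityI subsetI)
    fix x assume "x \<in> (\<lambda>Bs. (concat Bs, block_labels 1 Bs)) ` composition_lists r n"
    then obtain Bs where x: "x = (concat Bs, block_labels 1 Bs)" and Bs: "Bs \<in> composition_lists r n"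
      by blast
    have "[] \<notin> set Bs" using Bs by (simp add: composition_lists_def)
    then show "x \<in> labeled_compositions r n"
      using Bs set_block_labels[of Bs 1] hd_block_labels[of Bs 1] unit_steps_block_labels[of Bs 1]
      by (cases "Bs = []") (auto simp: x labeled_compositions_def composition_lists_def labeling_iff)
  next
    fix x assume "x \<in> labeled_compositions r n"
    then obtain \<gamma> L where x: "x = (\<gamma>, L)" "\<gamma> \<in> compositions n" "length \<gamma> = length L"
      and L: "set L \<subseteq> {1..r}" "L \<noteq> [] \<Longrightarrow> hd L = 1" "unit_steps L"
      by (auto simp: labeled_compositions_def labeling_iff)
    obtain Bs where Bs: "[] \<notin> set Bs" "concat Bs = \<gamma>" "block_labels 1 Bs = L"
      using ex_block_labels[OF x(3) L(3,2)] by blast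
    have "{1..<1 + length Bs} \<subseteq> {1..r}" using set_block_labels[OF Bs(1), of 1] Bs L by simp
    then have "length Bs \<le> r"
      using card_mono[of "{1..r}" "{1..<1 + length Bs}"] by simp
    then have "Bs \<in> composition_lists r n" using Bs x by (simp add: composition_lists_def)
    then show "x \<in> (\<lambda>Bs. (concat Bs, block_labels 1 Bs)) ` composition_lists r n"
      using Bs x by force
  qed
qed

lemma finite_labeled_compositions: "finite (labeled_compositions r n)"
proof (rule finite_subset)
  show "labeled_compositions r n \<subseteq> compositions n \<times> {L. set L \<subseteq> {1..r} \<and> length L \<le> n}"
    using length_le_sum_list
    by (fastforce simp: labeled_compositions_def labeling_def compositions_def)
qed (simp add: finite_lists_length_le)

lemma finite_composition_lists: "finite (composition_lists r n)"
  using bij_betw_finite[OF bij_betw_block_labels] finite_labeled_compositions by blast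

lemma sum_list_filter_nonzero: "sum_list (filter (\<lambda>x. x \<noteq> 0) w) = sum_list (w :: nat list)"
  by (induction w) auto

text \<open>Tuples are grouped by the composition that remains when zeros are deleted. Since
  \<open>f 0 = 1\<close>, the product is constant on each group, and the signs in a group add up to
  \<open>s_hat\<close>.\<close>

lemma sum_natpermute_s_hat:
  fixes f :: "nat \<Rightarrow> 'a :: comm_ring_1"
  assumes "f 0 = 1"
  shows "(\<Sum>w\<in>natpermute n r. of_int (s_hat_tuple r w) * (\<Prod>j<r. f (w ! j)))
    = (\<Sum>\<delta> | \<delta> \<in> compositions n \<and> length \<delta> \<le> r. of_int (s_hat r \<delta>) * (\<Prod>b\<leftarrow>\<delta>. f b))"
proof -
  let ?nz = "filter (\<lambda>x. x \<noteq> (0 :: nat))"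
  let ?T = "{\<delta>. \<delta> \<in> compositions n \<and> length \<delta> \<le> r}"
  have prod: "(\<Prod>j<r. f (w ! j)) = (\<Prod>b\<leftarrow>?nz w. f b)" if "length w = r" for w
  proof -
    have "(\<Prod>b\<leftarrow>?nz w. f b) = (\<Prod>b\<leftarrow>w. f b)"
      using assms by (induction w) auto
    then show ?thesis
      using that by (simp add: prod.list_conv_set_nth atLeast0LessThan)
  qed
  have "(\<Sum>w\<in>natpermute n r. of_int (s_hat_tuple r w) * (\<Prod>j<r. f (w ! j)))
      = (\<Sum>\<delta>\<in>?T. \<Sum>w | w \<in> natpermute n r \<and> ?nz w = \<delta>. of_int (s_hat_tuple r w) * (\<Prod>j<r. f (w ! j)))"
  proof (rule sum.group[symmetric])
    show "?nz ` natpermute n r \<subseteq> ?T"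
      by (auto simp: natpermute_def compositions_def composition_def sum_list_filter_nonzero[simplified])
  qed (auto simp: natpermute_finite)
  also have "\<dots> = (\<Sum>\<delta>\<in>?T. of_int (s_hat r \<delta>) * (\<Prod>b\<leftarrow>\<delta>. f b))"
  proof (rule sum.cong[OF refl])
    fix \<delta> assume \<delta>: "\<delta> \<in> ?T"
    have "{w. w \<in> natpermute n r \<and> ?nz w = \<delta>} = {w. length w = r \<and> ?nz w = \<delta>}"
      using \<delta> sum_list_filter_nonzero[simplified] by (auto simp: natpermute_def compositions_def)
    then show "(\<Sum>w | w \<in> natpermute n r \<and> ?nz w = \<delta>. of_int (s_hat_tuple r w) * (\<Prod>j<r. f (w ! j)))
        = of_int (s_hat r \<delta>) * (\<Prod>b\<leftarrow>\<delta>. f b)"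
      using \<delta> by (simp add: s_hat_def sum_distrib_right prod)
  qed
  finally show ?thesis .
qed

text \<open>Choosing a composition of every part of \<open>\<delta>\<close> amounts to choosing a
  list \<open>Bs\<close> with these block sums; the lengths in the exponents add up to the length of
  the concatenation.\<close>

lemma prod_signed_elementary:
  "(\<Prod>b\<leftarrow>\<delta>. signed_elementary i b)
    = (\<Sum>Bs | map sum_list Bs = \<delta> \<and> composition (concat Bs).
        of_int ((-1) ^ length (concat Bs)) * h_list i (concat Bs))"
proof -
  let ?g = "\<lambda>\<beta>. of_int ((-1) ^ length \<beta>) * h_list i \<beta>"
  have eq: "list_all2 (\<lambda>\<beta> b. \<beta> \<in> compositions b) Bs \<delta>
      \<longleftrightarrow> map sum_list Bs = \<delta> \<and> composition (concat Bs)" for Bs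
    by (induction Bs arbitrary: \<delta>)
      (auto simp: compositions_def composition_def list_all2_Cons1)
  have "(\<Prod>b\<leftarrow>\<delta>. signed_elementary i b) = (\<Prod>b\<leftarrow>\<delta>. \<Sum>\<beta>\<in>compositions b. ?g \<beta>)"
    unfolding signed_elementary_eq_compositions ..
  also have "\<dots> = (\<Sum>Bs | list_all2 (\<lambda>\<beta> b. \<beta> \<in> compositions b) Bs \<delta>. \<Prod>(b, \<beta>)\<leftarrow>zip \<delta> Bs. ?g \<beta>)"
    using prod_list_sum_list_all2[of \<delta> compositions "\<lambda>b. ?g"] by simp
  also have "\<dots> = (\<Sum>Bs | list_all2 (\<lambda>\<beta> b. \<beta> \<in> compositions b) Bs \<delta>. ?g (concat Bs))"
  proof (rule sum.cong[OF refl])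
    fix Bs assume "Bs \<in> {Bs. list_all2 (\<lambda>\<beta> b. \<beta> \<in> compositions b) Bs \<delta>}"
    then have "length \<delta> = length Bs" by (auto dest: list_all2_lengthD)
    then show "(\<Prod>(b, \<beta>)\<leftarrow>zip \<delta> Bs. ?g \<beta>) = ?g (concat Bs)"
      by (induction \<delta> Bs rule: list_induct2) (simp_all add: power_add)
  qed
  finally show ?thesis unfolding eq .
qed

text \<open>The list \<open>Bs\<close> becomes a labeled composition, and the composition
  \<open>\<delta>\<close> of block sums becomes its merged content. The factor (-1)^k, its own
  inverse, is moved over from the left side of \<open>elementary_expansion\<close>.\<close>

theorem elementary_eq_labeled_compositions:
  assumes "0 < r"
  shows "elementary i r k = (\<Sum>(\<gamma>, L)\<in>labeled_compositions r (r * k).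
    of_int ((-1) ^ length \<gamma> * (-1) ^ k * s_hat r (merge_labels \<gamma> L)) * h_list i \<gamma>)"
proof -
  let ?T = "{\<delta>. \<delta> \<in> compositions (r * k) \<and> length \<delta> \<le> r}"
  let ?g = "\<lambda>Bs. of_int (s_hat r (map sum_list Bs)) * (of_int ((-1) ^ length (concat Bs)) * h_list i (concat Bs))"
  have "of_int ((-1) ^ k) * elementary i r k
      = (\<Sum>\<delta>\<in>?T. of_int (s_hat r \<delta>) * (\<Prod>b\<leftarrow>\<delta>. signed_elementary i b))"
    unfolding elementary_expansion[OF assms] by (rule sum_natpermute_s_hat) simp
  also have "\<dots> = (\<Sum>\<delta>\<in>?T. \<Sum>Bs | map sum_list Bs = \<delta> \<and> composition (concat Bs). ?g Bs)"
    unfolding prod_signed_elementary sum_distrib_left by (intro sum.cong) auto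
  also have "\<dots> = (\<Sum>\<delta>\<in>?T. \<Sum>Bs | Bs \<in> composition_lists r (r * k) \<and> map sum_list Bs = \<delta>. ?g Bs)"
  proof (intro sum.cong refl Collect_cong)
    fix \<delta> Bs assume \<delta>: "\<delta> \<in> ?T"
    have "sum_list (concat Bs) = sum_list (map sum_list Bs)" for Bs :: "nat list list"
      by (induction Bs) simp_all
    \<comment> \<open>Blocks are nonempty because their sums are positive parts of
      \<open>\<delta>\<close>, and there are \<open>length \<delta> \<le> r\<close> of them.\<close>
    then show "(map sum_list Bs = \<delta> \<and> composition (concat Bs))
        = (Bs \<in> composition_lists r (r * k) \<and> map sum_list Bs = \<delta>)"
      using \<delta> by (fastforce simp: composition_lists_def compositions_def composition_def)
  qed
  also have "\<dots> = (\<Sum>Bs\<in>composition_lists r (r * k). ?g Bs)"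
  proof (rule sum.group[OF finite_composition_lists])
    show "map sum_list ` composition_lists r (r * k) \<subseteq> ?T"
    proof (rule image_subsetI)
      fix Bs assume Bs: "Bs \<in> composition_lists r (r * k)"
      have "sum_list (concat Bs) = sum_list (map sum_list Bs)" for Bs :: "nat list list"
        by (induction Bs) simp_all
      moreover have "0 < sum_list B" if "B \<in> set Bs" for B
      proof -
        have "B \<noteq> []" using that Bs by (auto simp: composition_lists_def)
        then obtain b B' where "B = b # B'" by (cases B) auto
        moreover have "0 < b" if "b \<in> set B" for b
          using that \<open>B \<in> set Bs\<close> Bs
          by (auto simp: composition_lists_def compositions_def composition_def)
        ultimately show ?thesis by simp
      qed
      ultimately show "map sum_list Bs \<in> ?T"
        using Bs by (auto simp: composition_lists_def compositions_def composition_def)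
    qed
  qed simp
  also have "\<dots> = (\<Sum>Bs\<in>composition_lists r (r * k).
      (\<lambda>(\<gamma>, L). of_int (s_hat r (merge_labels \<gamma> L)) * (of_int ((-1) ^ length \<gamma>) * h_list i \<gamma>))
        (concat Bs, block_labels 1 Bs))"
    by (intro sum.cong refl) (simp add: composition_lists_def merge_labels_block_labels[simplified])
  also have "\<dots> = (\<Sum>(\<gamma>, L)\<in>labeled_compositions r (r * k).
      of_int (s_hat r (merge_labels \<gamma> L)) * (of_int ((-1) ^ length \<gamma>) * h_list i \<gamma>))"
    by (rule sum.reindex_bij_betw[OF bij_betw_block_labels])
  finally have "of_int ((-1) ^ k) * elementary i r k = \<dots>" .
  then have "of_int ((-1) ^ k) * (of_int ((-1) ^ k) * elementary i r k)
      = of_int ((-1) ^ k) * (\<Sum>(\<gamma>, L)\<in>labeled_compositions r (r * k).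
      of_int (s_hat r (merge_labels \<gamma> L)) * (of_int ((-1) ^ length \<gamma>) * h_list i \<gamma>))"
    by (rule arg_cong)
  moreover have "of_int ((-1) ^ k) * (of_int ((-1) ^ k) * elementary i r k) = elementary i r k"
    by (simp flip: mult.assoc power_add)
  ultimately show ?thesis
    by (simp add: sum_distrib_left case_prod_unfold mult_ac)
qed

section \<open>Labeled polywrappings of a block\<close>

text \<open>Factors for different \<open>i\<close> involve disjoint sets of variables, so a monomial
  splits among them in at most one way and all coefficients are 0 or 1.\<close>

lemma coeff_prod_elementary:
  assumes "finite I" "0 < r"
  shows "coeff (\<Prod>i\<in>I. elementary i r (k i)) M = (if keys M \<subseteq> I \<times> {1..} \<and> (\<forall>v\<in>keys M. lookup M v = r)
    \<and> (\<forall>i\<in>I. card (keys M \<inter> {i} \<times> UNIV) = k i) then 1 else 0)"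
  using assms(1)
proof (induction I arbitrary: M rule: finite_induct)
  case (insert i I)
  define C where "C \<longleftrightarrow> keys M \<subseteq> insert i I \<times> {1..} \<and> (\<forall>v\<in>keys M. lookup M v = r)
    \<and> (\<forall>j\<in>insert i I. card (keys M \<inter> {j} \<times> UNIV) = k j)"
  \<comment> \<open>The only possible splitting of \<open>M\<close>: its variables in row
    \<open>i\<close> and those in the rows of \<open>I\<close>.\<close>
  define a0 where "a0 = constant_monom r (keys M \<inter> {i} \<times> UNIV)"
  define b0 where "b0 = constant_monom r (keys M \<inter> I \<times> UNIV)"
  have keys0: "keys a0 = keys M \<inter> {i} \<times> UNIV" "keys b0 = keys M \<inter> I \<times> UNIV"
    using assms(2) by (simp_all add: a0_def b0_def keys_constant_monom)
  have lookup0: "lookup a0 v = (if v \<in> keys M \<inter> {i} \<times> UNIV then r else 0)"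
    "lookup b0 v = (if v \<in> keys M \<inter> I \<times> UNIV then r else 0)" for v
    by (simp_all add: a0_def b0_def lookup_constant_monom)
  have sum0: "a0 + b0 = M" if C
  proof (rule poly_mapping_eqI)
    fix v
    show "lookup (a0 + b0) v = lookup M v"
    proof (cases "v \<in> keys M")
      case True
      then have "v \<in> {i} \<times> UNIV \<or> v \<in> I \<times> UNIV" "lookup M v = r" using that by (auto simp: C_def)
      then show ?thesis using True insert.hyps by (auto simp: lookup_add lookup0)
    next
      case False
      then show ?thesis by (simp add: lookup_add lookup0 in_keys_iff)
    qed
  qed
  have "coeff (elementary i r (k i)) a * coeff (\<Prod>i\<in>I. elementary i r (k i)) b
      = (if (a, b) = (a0, b0) then (if C then 1 else 0) else 0)" if M: "a + b = M" for a b
  proof -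
    let ?A = "keys a \<subseteq> {i} \<times> {1..} \<and> (\<forall>v\<in>keys a. lookup a v = r) \<and> card (keys a) = k i"
    let ?B = "keys b \<subseteq> I \<times> {1..} \<and> (\<forall>v\<in>keys b. lookup b v = r)
      \<and> (\<forall>j\<in>I. card (keys b \<inter> {j} \<times> UNIV) = k j)"
    have "(?A \<and> ?B) \<longleftrightarrow> (a, b) = (a0, b0) \<and> C"
    proof
      assume AB: "?A \<and> ?B"
      have M': "keys M = keys a \<union> keys b" using M by (auto simp: keys_add_nat)
      have Mi: "keys M \<inter> {i} \<times> UNIV = keys a" and MI: "keys M \<inter> I \<times> UNIV = keys b"
        using AB M' insert.hyps by auto
      have "a0 = a" "b0 = b"
        using AB assms(2) eq_constant_monom_iff[of "keys a" r a] eq_constant_monom_iff[of "keys b" r b]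
        by (auto simp: a0_def b0_def Mi MI)
      moreover have "lookup M v = r" if "v \<in> keys M" for v
      proof -
        have "v \<in> keys a \<and> v \<notin> keys b \<or> v \<in> keys b \<and> v \<notin> keys a"
          using that M' AB insert.hyps by auto
        then show ?thesis using AB by (auto simp: lookup_add in_keys_iff simp flip: M)
      qed
      moreover have "card (keys M \<inter> {j} \<times> UNIV) = k j" if "j \<in> insert i I" for j
      proof (cases "j = i")
        case False
        then have "keys M \<inter> {j} \<times> UNIV = keys b \<inter> {j} \<times> UNIV" using M' AB by auto
        then show ?thesis using AB that False by simp
      qed (use Mi AB in simp)
      moreover have "keys M \<subseteq> insert i I \<times> {1..}" using M' AB by auto
      ultimately show "(a, b) = (a0, b0) \<and> C" by (simp add: C_def)
    next
      assume R: "(a, b) = (a0, b0) \<and> C"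
      have I: "keys M \<inter> I \<times> UNIV \<inter> {j} \<times> UNIV = keys M \<inter> {j} \<times> UNIV" if "j \<in> I" for j
        using that by auto
      have ab: "a = a0" "b = b0" and C using R by auto
      have ?A unfolding ab keys0 lookup0 using \<open>C\<close> unfolding C_def by auto
      moreover have "keys b \<subseteq> I \<times> {1..} \<and> (\<forall>v\<in>keys b. lookup b v = r)"
        unfolding ab keys0 lookup0 using \<open>C\<close> unfolding C_def by auto
      moreover have "card (keys b \<inter> {j} \<times> UNIV) = k j" if "j \<in> I" for j
        unfolding ab keys0 I[OF that] using \<open>C\<close> that unfolding C_def by auto
      ultimately show "?A \<and> ?B" by blast
    qed
    have if_conj: "(if P then 1 else 0) * (if Q then 1 else 0) = (if P \<and> Q then 1 else (0 :: rat))"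
      for P Q by simp
    have "coeff (elementary i r (k i)) a * coeff (\<Prod>i\<in>I. elementary i r (k i)) b
        = (if ?A \<and> ?B then 1 else 0)"
      unfolding insert.IH unfolding elementary_def coeff_Series by (rule if_conj)
    also have "\<dots> = (if (a, b) = (a0, b0) \<and> C then 1 else 0)"
      unfolding \<open>(?A \<and> ?B) \<longleftrightarrow> (a, b) = (a0, b0) \<and> C\<close> ..
    finally show ?thesis by simp
  qed
  then have "coeff (\<Prod>i\<in>insert i I. elementary i r (k i)) M
      = (\<Sum>x | fst x + snd x = M. if x = (a0, b0) then (if C then 1 else 0) else 0)"
    unfolding coeff_mult prod.insert[OF insert.hyps(1,2)]
    by (intro sum.cong) (simp_all add: case_prod_unfold prod_eq_iff)
  also have "\<dots> = (if C then 1 else 0)"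
    using finite_splittings[of M] sum0 by (auto simp: sum.delta case_prod_unfold)
  finally show ?case by (simp only: C_def)
qed auto

lemma coeff_E_plus_block:
  assumes "0 < r"
  shows "coeff (E_plus_block d r) M = (if keys M \<subseteq> {1..} \<times> {1..} \<and> (\<forall>v\<in>keys M. lookup M v = r)
    \<and> (\<Sum>v\<in>keys M. fst v) = d then 1 else 0)"
proof -
  define M' where "M' = Poly_Mapping.map (\<lambda>e. e div r) M"
  have lookup': "lookup M' v = lookup M v div r" for v
    by (simp add: M'_def Poly_Mapping.map.rep_eq when_def)
  show ?thesis
  proof (cases "\<forall>v. r dvd lookup M v")
    case True
    then have r: "lookup M v = r * lookup M' v" for v unfolding lookup' by (metis dvd_mult_div_cancel)
    have keys': "keys M' = keys M" using assms by (auto simp: in_keys_iff r)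
    have le1: "(\<forall>v. lookup M' v \<le> 1) \<longleftrightarrow> (\<forall>v\<in>keys M. lookup M v = r)"
    proof
      assume *: "\<forall>v\<in>keys M. lookup M v = r"
      show "\<forall>v. lookup M' v \<le> 1"
      proof
        fix v
        show "lookup M' v \<le> 1"
          using * assms by (cases "v \<in> keys M") (auto simp: lookup' in_keys_iff)
      qed
    next
      assume *: "\<forall>v. lookup M' v \<le> 1"
      show "\<forall>v\<in>keys M. lookup M v = r"
      proof
        fix v assume "v \<in> keys M"
        then have "lookup M' v \<noteq> 0" by (simp add: in_keys_iff flip: keys')
        then have "lookup M' v = 1" using *[rule_format, of v] by simp
        then show "lookup M v = r" by (simp add: r)
      qed
    qed
    have "monom_degree M' = (\<Sum>v\<in>keys M. fst v)" if "\<forall>v\<in>keys M. lookup M v = r"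
      unfolding monom_degree_def keys' using that assms
      by (intro sum.cong refl) (auto simp: lookup')
    then show ?thesis
      using True le1 by (auto simp: E_plus_block_def power_subst_def E_plus_degree_def keys' simp flip: M'_def)
  next
    case False
    then obtain v where v: "\<not> r dvd lookup M v" by blast
    then have "v \<in> keys M" "lookup M v \<noteq> r" by (metis dvd_0_right in_keys_iff, auto)
    then show ?thesis using False by (auto simp: E_plus_block_def power_subst_def)
  qed
qed

text \<open>Monomials are sorted by the number \<open>m i\<close> of their variables of degree
  \<open>i\<close>. The bound \<open>m i \<le> d\<close> and the extensional function space make the
  index set finite and each \<open>m\<close> unique.\<close>

lemma E_plus_block_eq_elementary:
  assumes "0 < r"
  shows "E_plus_block d r = (\<Sum>m | m \<in> {1..d} \<rightarrow>\<^sub>E {..d} \<and> (\<Sum>i=1..d. i * m i) = d.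
    \<Prod>i=1..d. elementary i r (m i))"
proof (rule series_eqI)
  fix M
  define good where "good \<longleftrightarrow> keys M \<subseteq> {1..} \<times> {1..} \<and> (\<forall>v\<in>keys M. lookup M v = r)
    \<and> (\<Sum>v\<in>keys M. fst v) = d"
  define m0 where "m0 = (\<lambda>i\<in>{1..d}. card (keys M \<inter> {i} \<times> UNIV))"
  let ?S = "{m \<in> {1..d} \<rightarrow>\<^sub>E {..d}. (\<Sum>i=1..d. i * m i) = d}"
  have degree: "(\<Sum>v\<in>keys M. fst v) = (\<Sum>i=1..d. i * card (keys M \<inter> {i} \<times> UNIV))"
    if "keys M \<subseteq> {1..d} \<times> {1..}"
  proof -
    have "(\<Sum>v\<in>keys M. fst v) = (\<Sum>i\<in>{1..d}. \<Sum>v | v \<in> keys M \<and> fst v = i. fst v)"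
      by (rule sum.group[symmetric]) (use that in auto)
    also have "\<dots> = (\<Sum>i\<in>{1..d}. \<Sum>v\<in>keys M \<inter> {i} \<times> UNIV. i)"
      by (intro sum.cong) auto
    finally show ?thesis by (simp add: mult.commute)
  qed
  have good_keys: "keys M \<subseteq> {1..d} \<times> {1..}" if good
  proof
    fix v assume v: "v \<in> keys M"
    have "fst v \<le> (\<Sum>v\<in>keys M. fst v)" by (rule member_le_sum) (use v in auto)
    then show "v \<in> {1..d} \<times> {1..}" using that v by (auto simp: good_def)
  qed
  have m0: "m0 \<in> ?S" if good
  proof -
    have eq: "(\<Sum>i=1..d. i * card (keys M \<inter> {i} \<times> UNIV)) = d"
      using degree[OF good_keys[OF that]] that by (simp add: good_def)
    have "card (keys M \<inter> {i} \<times> UNIV) \<le> d" if i: "i \<in> {1..d}" for i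
    proof -
      have "card (keys M \<inter> {i} \<times> UNIV) \<le> i * card (keys M \<inter> {i} \<times> UNIV)" using i by simp
      also have "\<dots> \<le> (\<Sum>i=1..d. i * card (keys M \<inter> {i} \<times> UNIV))"
        using i by (intro member_le_sum[of i]) auto
      finally show ?thesis using eq by simp
    qed
    then show ?thesis using eq by (auto simp: m0_def)
  qed
  have "coeff (\<Prod>i=1..d. elementary i r (m i)) M = (if m = m0 then (if good then 1 else 0) else 0)"
    if m: "m \<in> ?S" for m
  proof -
    have "(keys M \<subseteq> {1..d} \<times> {1..} \<and> (\<forall>v\<in>keys M. lookup M v = r)
        \<and> (\<forall>i\<in>{1..d}. card (keys M \<inter> {i} \<times> UNIV) = m i)) \<longleftrightarrow> m = m0 \<and> good" (is "?L \<longleftrightarrow> ?R")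
    proof
      assume L: ?L
      have "m = m0"
      proof
        fix i
        show "m i = m0 i" using L m by (cases "i \<in> {1..d}") (auto simp: m0_def)
      qed
      moreover have good
        using L degree m by (auto simp: good_def)
      ultimately show ?R by simp
    next
      assume ?R
      then show ?L using good_keys by (auto simp: good_def m0_def)
    qed
    then show ?thesis
      using coeff_prod_elementary[OF finite_atLeastAtMost[of 1 d] assms, of m M] by simp
  qed
  then have "coeff (\<Sum>m\<in>?S. \<Prod>i=1..d. elementary i r (m i)) M
      = (\<Sum>m\<in>?S. if m = m0 then (if good then 1 else 0) else 0)"
    unfolding coeff_sum by (rule sum.cong[OF refl])
  also have "\<dots> = (if good then 1 else 0)"
  proof -
    have "finite ({1..d} \<rightarrow>\<^sub>E {..d})" by (intro finite_PiE) auto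
    then have "finite ?S" by simp
    then show ?thesis using m0 by (subst sum.delta) auto
  qed
  finally show "coeff (E_plus_block d r) M
      = coeff (\<Sum>m\<in>?S. \<Prod>i=1..d. elementary i r (m i)) M"
    by (simp add: coeff_E_plus_block[OF assms] good_def)
qed

section \<open>Rectangles of a wrapping and their sizes\<close>

lemma length_group_columns [simp]: "length (group_columns \<beta> cs) = length \<beta>"
  by (induction \<beta> cs rule: group_columns.induct) simp_all

lemma card_Union_disjoint_list:
  assumes "sorted_wrt (\<lambda>A B. A \<inter> B = {}) cs" "\<forall>A\<in>set cs. finite A \<and> card A = k"
  shows "card (\<Union> (set cs)) = k * length cs"
  using assms
proof (induction cs)
  case (Cons A cs)
  then have "A \<inter> \<Union> (set cs) = {}" "finite (\<Union> (set cs))" by auto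
  then show ?case using Cons by (simp add: card_Un_disjoint)
qed simp

text \<open>\<open>label_type\<close> counts boxes; the count is recovered from the content because
  the columns are disjoint, of equal size, and numerous enough that no \<open>take\<close> falls
  short.\<close>

lemma card_group_columns:
  assumes "sorted_wrt (\<lambda>A B. A \<inter> B = {}) cs" "\<forall>A\<in>set cs. finite A \<and> card A = k"
    "sum_list \<beta> \<le> length cs" "j < length \<beta>"
  shows "card (group_columns \<beta> cs ! j) = k * \<beta> ! j"
  using assms
proof (induction \<beta> cs arbitrary: j rule: group_columns.induct)
  case (2 b \<beta> cs)
  have "card (\<Union> (set (take b cs))) = k * b"
    using card_Union_disjoint_list[of "take b cs" k] 2(2-4)
    by (auto simp: sorted_wrt_take dest: in_set_takeD)
  moreover have "card (group_columns \<beta> (drop b cs) ! i) = k * \<beta> ! i" if "i < length \<beta>" for i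
    using 2(2-4) that by (intro 2(1)) (auto simp: sorted_wrt_drop dest: in_set_dropD)
  ultimately show ?case using 2(5) by (cases j) auto
qed simp

lemma sheet_columns_eq:
  "sheet_columns t d r k = concat (map (\<lambda>s. map (\<lambda>c. {t + s * k ..< t + (s + 1) * k} \<times> {c}) [0..<r])
    [0..<d div k])"
  by (simp add: sheet_columns_def)

lemma length_sheet_columns [simp]: "length (sheet_columns t d r k) = d div k * r"
  by (simp add: sheet_columns_eq length_concat comp_def sum_list_triv)

lemma card_sheet_columns: "A \<in> set (sheet_columns t d r k) \<Longrightarrow> finite A \<and> card A = k"
  by (auto simp: sheet_columns_eq card_cartesian_product)

text \<open>Columns of one sheet differ in the column index; columns of different sheets occupy
  disjoint intervals of rows.\<close>

lemma disjoint_sheet_columns: "sorted_wrt (\<lambda>A B. A \<inter> B = {}) (sheet_columns t d r k)"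
proof -
  let ?row = "\<lambda>s. map (\<lambda>c. {t + s * k ..< t + (s + 1) * k} \<times> {c}) [0..<r]"
  have row: "sorted_wrt (\<lambda>A B. A \<inter> B = {}) (?row s)" for s
    by (simp add: sorted_wrt_map) (rule sorted_wrt_mono_rel[OF _ sorted_wrt_upt], auto)
  have "sorted_wrt (\<lambda>A B. A \<inter> B = {}) (concat (map ?row [0..<n]))" for n
  proof (induction n)
    case (Suc n)
    have "A \<inter> B = {}" if A': "A \<in> set (concat (map ?row [0..<n]))" and B': "B \<in> set (?row n)" for A B
    proof -
      obtain s c where A: "s < n" "A = {t + s * k ..< t + (s + 1) * k} \<times> {c}" using A' by auto
      obtain c' where B: "B = {t + n * k ..< t + (n + 1) * k} \<times> {c'}" using B' by auto
      have "(s + 1) * k \<le> n * k" using A by (intro mult_right_mono) auto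
      then show ?thesis unfolding A B by auto
    qed
    then show ?case
      using Suc row[of n] by (simp only: upt_Suc_append map_append concat_append sorted_wrt_append
          le0 list.map concat.simps append_Nil2) blast
  qed simp
  then show ?thesis by (simp only: sheet_columns_eq)
qed

text \<open>A group of \<open>k * area div r\<close> rows has \<open>area div r\<close> sheets with
  \<open>r\<close> columns each. As \<open>r\<close> divides the area, this is exactly the number of
  columns that the content asks for.\<close>

lemma card_polywrapping:
  assumes r: "0 < r" and \<gamma>: "\<gamma> \<in> OTyp r n" and j: "j < length (\<gamma> k)"
  shows "card (polywrapping r \<gamma> k ! j) = k * \<gamma> k ! j"
proof -
  have "0 < k" using \<gamma> j by (auto simp: OTyp_def ordered_types_def intro: gr0I)
  obtain m where m: "area (\<gamma> k) = r * m" using \<gamma> by (auto simp: OTyp_def)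
  have "group_rows r \<gamma> k div k * r = area (\<gamma> k)"
    using \<open>0 < k\<close> r by (simp add: group_rows_def m mult.left_commute[of k])
  then show ?thesis
    unfolding polywrapping_def wrapping_def
    by (intro card_group_columns disjoint_sheet_columns ballI card_sheet_columns j) auto
qed

lemma length_polywrapping [simp]: "length (polywrapping r \<gamma> k) = length (\<gamma> k)"
  by (simp add: polywrapping_def wrapping_def)

lemma label_type_eq:
  assumes "0 < r" "D \<in> labeled_polywrappings d r"
  shows "label_type D k = merge_labels (pocon D k) (labels D k)"
proof -
  let ?J = "\<lambda>i. {j. j < length (labels D k) \<and> labels D k ! j = i}"
  have D: "pocon D \<in> OTyp r (d * r)" "rectangles D = polywrapping r (pocon D)"
    "length (labels D k) = length (pocon D k)"
    using assms by (auto simp: labeled_polywrappings_def)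
  have "(\<Sum>j\<in>?J i. card (rectangles D k ! j)) div k = (\<Sum>j\<in>?J i. pocon D k ! j)" for i
  proof -
    have "(\<Sum>j\<in>?J i. card (rectangles D k ! j)) = (\<Sum>j\<in>?J i. k * pocon D k ! j)"
      using D by (intro sum.cong refl) (simp add: card_polywrapping[OF assms(1)])
    \<comment> \<open>At height 0 the division by \<open>k\<close> yields 0, in agreement with the
      empty sum: there are no rectangles.\<close>
    moreover have "0 < k \<or> ?J i = {}" using D by (cases "k = 0") (auto simp: OTyp_def ordered_types_def)
    ultimately show ?thesis by (auto simp flip: sum_distrib_left)
  qed
  then show ?thesis by (simp add: label_type_def merge_labels_def)
qed

lemma sum_list_merge_labels:
  assumes "(\<gamma>, L) \<in> labeled_compositions r n"
  shows "sum_list (merge_labels \<gamma> L) = n"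
proof -
  obtain Bs where Bs: "Bs \<in> composition_lists r n" "\<gamma> = concat Bs" "L = block_labels 1 Bs"
    using assms unfolding bij_betw_imp_surj_on[OF bij_betw_block_labels, symmetric] by blast
  have "sum_list (map sum_list Bs) = sum_list (concat Bs)" by (induction Bs) simp_all
  then show ?thesis
    using assms Bs merge_labels_block_labels[of Bs]
    by (auto simp: composition_lists_def labeled_compositions_def compositions_def)
qed

text \<open>A nonempty component \<open>i\<close> has positive area divisible by \<open>r\<close>,
  so it alone contributes at least \<open>i * r\<close> to the total \<open>d * r\<close>.\<close>

lemma OTyp_supp:
  assumes "0 < r" "\<gamma> \<in> OTyp r (d * r)"
  shows "supp \<gamma> \<subseteq> {1..d}"
proof
  fix i assume i: "i \<in> supp \<gamma>"
  then have i0: "i \<noteq> 0" using assms by (cases "i = 0") (auto simp: supp_def OTyp_def ordered_types_def)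
  have "0 < area (\<gamma> i)"
    using i assms length_le_sum_list[of "\<gamma> i"]
    by (auto simp: supp_def OTyp_def ordered_types_def intro: gr0I)
  then have "r \<le> area (\<gamma> i)" using assms by (auto simp: OTyp_def intro: dvd_imp_le)
  then have "i * r \<le> i * area (\<gamma> i)" by simp
  also have "\<dots> \<le> (\<Sum>i\<in>supp \<gamma>. i * area (\<gamma> i))"
    using i assms by (intro member_le_sum[of i]) (auto simp: OTyp_def ordered_types_def)
  also have "\<dots> = d * r" using assms by (simp add: OTyp_def ordered_types_def)
  finally show "i \<in> {1..d}" using i0 assms by simp
qed

lemma h_tensor_superset:
  assumes "supp \<gamma> \<subseteq> I" "finite I"
  shows "h_tensor \<gamma> = (\<Prod>i\<in>I. h_list i (\<gamma> i))"
  unfolding h_tensor_def using assms by (intro prod.mono_neutral_left) (auto simp: supp_def)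


lemma s_hat_otype_superset:
  assumes "supp \<delta> \<subseteq> I" "finite I"
  shows "s_hat_otype r \<delta> = (\<Prod>i\<in>I. s_hat r (\<delta> i))"
  unfolding s_hat_otype_def using assms
  by (intro prod.mono_neutral_left) (auto simp: supp_def s_hat_Nil)

lemma labeled_polywrapping_components:
  assumes "0 < r" "D \<in> labeled_polywrappings d r"
  shows "(pocon D i, labels D i) \<in> labeled_compositions r (r * (area (pocon D i) div r))"
  using assms
  by (auto simp: labeled_polywrappings_def labeled_compositions_def compositions_def OTyp_def
      ordered_types_def)

text \<open>The sign factors over the heights. For the exponent \<open>otype_area div r\<close> this
  holds because merging labels preserves the area at each height, and each area is a multiple of
  \<open>r\<close>.\<close>

lemma psgn_polywrapping_eq:
  assumes r: "0 < r" and D: "D \<in> labeled_polywrappings d r"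
  shows "psgn_polywrapping r D = (\<Prod>i=1..d. (-1) ^ length (pocon D i)
    * (-1) ^ (area (pocon D i) div r) * s_hat r (merge_labels (pocon D i) (labels D i)))"
proof -
  let ?m = "\<lambda>i. area (pocon D i) div r"
  have lt: "label_type D = (\<lambda>i. merge_labels (pocon D i) (labels D i))"
    using label_type_eq[OF assms] by blast
  have supp: "supp (pocon D) \<subseteq> {1..d}"
    using OTyp_supp[OF r] D by (auto simp: labeled_polywrappings_def)
  have "label_type D i = []" if "pocon D i = []" for i
  proof -
    have "length (labels D i) = length (pocon D i)" using D by (simp add: labeled_polywrappings_def)
    then show ?thesis using that by (simp add: lt merge_labels_def)
  qed
  then have supp': "supp (label_type D) \<subseteq> {1..d}" using supp by (auto simp: supp_def)
  have "otype_length (pocon D) = (\<Sum>i=1..d. length (pocon D i))"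
    unfolding otype_length_def using supp by (intro sum.mono_neutral_left) (auto simp: supp_def)
  moreover have "otype_area (label_type D) div r = (\<Sum>i=1..d. ?m i)"
  proof -
    have "otype_area (label_type D) = (\<Sum>i=1..d. area (label_type D i))"
      unfolding otype_area_def using supp' by (intro sum.mono_neutral_left) (auto simp: supp_def)
    also have "\<dots> = (\<Sum>i=1..d. r * ?m i)"
      using sum_list_merge_labels[OF labeled_polywrapping_components[OF assms]] by (simp add: lt)
    finally show ?thesis using r by (simp flip: sum_distrib_left)
  qed
  ultimately show ?thesis
    unfolding psgn_polywrapping_def s_hat_otype_superset[OF supp' finite_atLeastAtMost]
    by (simp add: lt power_sum prod.distrib)
qed

text \<open>Multiplying out over the heights selects degrees \<open>m\<close> and a labeled
  composition of \<open>r * m i\<close> for each \<open>i\<close>. This is a labeled polywrapping,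
  whose rectangles are determined by its content.\<close>

theorem E_plus_block_eq_labeled_polywrappings:
  assumes r: "0 < r"
  shows "finite (labeled_polywrappings d r)"
    and "E_plus_block d r
      = (\<Sum>D\<in>labeled_polywrappings d r. of_int (psgn_polywrapping r D) * h_tensor (pocon D))"
proof -
  let ?I = "{1..d}"
  let ?S = "{m \<in> ?I \<rightarrow>\<^sub>E {..d}. (\<Sum>i=1..d. i * m i) = d}"
  let ?P = "\<lambda>m. Pi\<^sub>E ?I (\<lambda>i. labeled_compositions r (r * m i))"
  let ?w = "\<lambda>i m (\<gamma>, L). of_int ((-1) ^ length \<gamma> * (-1) ^ m * s_hat r (merge_labels \<gamma> L)) * h_list i \<gamma>"
  \<comment> \<open>The degree \<open>m i\<close> is recovered as the area at height
    \<open>i\<close> divided by \<open>r\<close>.\<close>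
  define F where "F D = ((\<lambda>i\<in>?I. area (pocon D i) div r), (\<lambda>i\<in>?I. (pocon D i, labels D i)))"
    for D :: labeled_polywrapping
  define G where "G x = (let \<gamma> = (\<lambda>i. if i \<in> ?I then fst (snd x i) else []) in
    \<lparr>pocon = \<gamma>, rectangles = polywrapping r \<gamma>, labels = (\<lambda>i. if i \<in> ?I then snd (snd x i) else [])\<rparr>)"
    for x :: "(nat \<Rightarrow> nat) \<times> (nat \<Rightarrow> nat list \<times> nat list)"
  have finS: "finite ?S"
    using finite_PiE[of ?I "\<lambda>_. {..d}"] by simp
  have finP: "finite (?P m)" for m
    by (intro finite_PiE finite_labeled_compositions) simp
  have GF: "G (F D) = D" if D: "D \<in> labeled_polywrappings d r" for D
  proof -
    have "supp (pocon D) \<subseteq> ?I"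
      using OTyp_supp[OF r] D by (auto simp: labeled_polywrappings_def)
    then have "pocon D i = []" if "i \<notin> ?I" for i using that unfolding supp_def by blast
    then have p: "(\<lambda>i. if i \<in> ?I then fst (snd (F D) i) else []) = pocon D"
      by (intro ext) (simp add: F_def)
    have "length (labels D i) = length (pocon D i)" for i
      using D by (auto simp: labeled_polywrappings_def)
    then have "labels D i = []" if "i \<notin> ?I" for i
      using \<open>\<And>i. i \<notin> ?I \<Longrightarrow> pocon D i = []\<close>[OF that] by (metis length_0_conv)
    then have l: "(\<lambda>i. if i \<in> ?I then snd (snd (F D) i) else []) = labels D"
      by (intro ext) (simp add: F_def)
    have "G (F D) = \<lparr>pocon = pocon D, rectangles = polywrapping r (pocon D), labels = labels D\<rparr>"
      unfolding G_def p l Let_def ..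
    then show ?thesis using D by (simp add: labeled_polywrappings_def)
  qed
  have F: "F D \<in> Sigma ?S ?P" if D: "D \<in> labeled_polywrappings d r" for D
  proof -
    have \<gamma>: "pocon D \<in> OTyp r (d * r)" using D by (simp add: labeled_polywrappings_def)
    then have supp: "supp (pocon D) \<subseteq> ?I" by (rule OTyp_supp[OF r])
    have "(\<Sum>i\<in>supp (pocon D). i * area (pocon D i)) = d * r"
      using \<gamma> by (simp add: OTyp_def ordered_types_def)
    also have "(\<Sum>i\<in>supp (pocon D). i * area (pocon D i)) = (\<Sum>i=1..d. i * area (pocon D i))"
      using supp by (intro sum.mono_neutral_left) (auto simp: supp_def)
    also have "\<dots> = (\<Sum>i=1..d. i * (area (pocon D i) div r) * r)"
      using \<gamma> by (intro sum.cong refl) (simp add: OTyp_def mult.assoc)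
    finally have sum: "(\<Sum>i=1..d. i * (area (pocon D i) div r)) = d"
      using r by (simp flip: sum_distrib_right)
    moreover have "area (pocon D i) div r \<le> d" if i: "i \<in> ?I" for i
    proof -
      have "area (pocon D i) div r \<le> i * (area (pocon D i) div r)" using i by simp
      also have "\<dots> \<le> (\<Sum>i=1..d. i * (area (pocon D i) div r))"
        using i by (intro member_le_sum[of i ?I "\<lambda>i. i * (area (pocon D i) div r)"]) auto
      finally show ?thesis using sum by simp
    qed
    ultimately show ?thesis
      using labeled_polywrapping_components[OF r D] by (auto simp: F_def)
  qed
  have G: "G x \<in> labeled_polywrappings d r \<and> F (G x) = x" if x: "x \<in> Sigma ?S ?P" for x
  proof -
    obtain m f where mf: "x = (m, f)" "m \<in> ?S" "f \<in> ?P m" using x by auto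
    define \<gamma> where "\<gamma> = (\<lambda>i. if i \<in> ?I then fst (f i) else [])"
    define L where "L = (\<lambda>i. if i \<in> ?I then snd (f i) else [])"
    have Gx: "G x = \<lparr>pocon = \<gamma>, rectangles = polywrapping r \<gamma>, labels = L\<rparr>"
      unfolding G_def mf(1) \<gamma>_def L_def Let_def snd_conv ..
    have f: "composition (\<gamma> i)" "area (\<gamma> i) = r * m i" "length (L i) = length (\<gamma> i)"
      "labeling r (L i)" if "i \<in> ?I" for i
      using PiE_mem[OF mf(3) that] that
      by (auto simp: \<gamma>_def L_def labeled_compositions_def compositions_def)
    have out: "\<gamma> i = []" "L i = []" if "i \<notin> ?I" for i
      using that by (simp_all only: \<gamma>_def L_def if_False)
    have supp: "supp \<gamma> \<subseteq> ?I" using out by (auto simp only: supp_def)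
    have "(\<Sum>i\<in>supp \<gamma>. i * area (\<gamma> i)) = (\<Sum>i=1..d. i * area (\<gamma> i))"
      using supp by (intro sum.mono_neutral_left) (auto simp: supp_def)
    also have "\<dots> = (\<Sum>i=1..d. i * m i * r)" by (intro sum.cong refl) (simp add: f)
    also have "\<dots> = d * r" using mf(2) by (simp flip: sum_distrib_right)
    finally have "(\<Sum>i\<in>supp \<gamma>. i * area (\<gamma> i)) = d * r" .
    moreover have "composition (\<gamma> i)" "r dvd area (\<gamma> i)" "length (L i) = length (\<gamma> i)" "labeling r (L i)" for i
      using f[of i] out[of i] by (cases "i \<in> ?I"; simp add: composition_def labeling_def)+
    ultimately have "G x \<in> labeled_polywrappings d r"
      using supp finite_subset[OF supp] out(1)[of 0]
      by (simp add: Gx labeled_polywrappings_def OTyp_def ordered_types_def)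
    moreover have "(\<lambda>i\<in>?I. area (\<gamma> i) div r) = m"
      using mf(2) r f(2) by (auto simp: fun_eq_iff PiE_def extensional_def restrict_def)
    moreover have "(\<lambda>i\<in>?I. (\<gamma> i, L i)) = f"
      using mf(3) by (auto simp: fun_eq_iff PiE_def extensional_def restrict_def \<gamma>_def L_def)
    ultimately show ?thesis unfolding F_def Gx by (simp add: mf(1))
  qed
  have bij: "bij_betw F (labeled_polywrappings d r) (Sigma ?S ?P)"
    using F G GF by (intro bij_betw_byWitness[of _ G]) blast+
  show "finite (labeled_polywrappings d r)"
    using bij_betw_finite[OF bij] finS finP by blast
  have "E_plus_block d r = (\<Sum>m\<in>?S. \<Prod>i\<in>?I. \<Sum>x\<in>labeled_compositions r (r * m i). ?w i (m i) x)"
    unfolding E_plus_block_eq_elementary[OF r] elementary_eq_labeled_compositions[OF r] ..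
  also have "\<dots> = (\<Sum>m\<in>?S. \<Sum>f\<in>?P m. \<Prod>i\<in>?I. ?w i (m i) (f i))"
    by (intro sum.cong refl prod_sum_PiE finite_labeled_compositions) simp
  also have "\<dots> = (\<Sum>x\<in>Sigma ?S ?P. \<Prod>i\<in>?I. ?w i (fst x i) (snd x i))"
    using finS finP by (subst sum.Sigma) (simp_all add: case_prod_unfold)
  also have "\<dots> = (\<Sum>D\<in>labeled_polywrappings d r. \<Prod>i\<in>?I. ?w i (fst (F D) i) (snd (F D) i))"
    by (rule sum.reindex_bij_betw[OF bij, symmetric])
  also have "\<dots> = (\<Sum>D\<in>labeled_polywrappings d r. of_int (psgn_polywrapping r D) * h_tensor (pocon D))"
  proof (rule sum.cong[OF refl])
    fix D assume D: "D \<in> labeled_polywrappings d r"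
    have supp: "supp (pocon D) \<subseteq> ?I"
      using OTyp_supp[OF r] D by (auto simp: labeled_polywrappings_def)
    have "(\<Prod>i\<in>?I. ?w i (fst (F D) i) (snd (F D) i))
        = (\<Prod>i\<in>?I. of_int ((-1) ^ length (pocon D i) * (-1) ^ (area (pocon D i) div r)
            * s_hat r (merge_labels (pocon D i) (labels D i))) * h_list i (pocon D i))"
      by (intro prod.cong refl) (simp add: F_def)
    then show "(\<Prod>i\<in>?I. ?w i (fst (F D) i) (snd (F D) i))
        = of_int (psgn_polywrapping r D) * h_tensor (pocon D)"
      unfolding psgn_polywrapping_eq[OF r D] h_tensor_superset[OF supp finite_atLeastAtMost]
        of_int_prod prod.distrib[symmetric] .
  qed
  finally show "E_plus_block d r
      = (\<Sum>D\<in>labeled_polywrappings d r. of_int (psgn_polywrapping r D) * h_tensor (pocon D))" .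
qed

section \<open>The basis of complete homogeneous functions\<close>

text \<open>Products are indexed by multisets of blocks rather than types: union of multisets is
  multiplication, and the content of a tabloid is such a union.\<close>

definition h_mset :: "(nat \<times> nat) multiset \<Rightarrow> series" where
  "h_mset B = (\<Prod>(i, b)\<in>#B. complete_h i b)"

definition e_mset :: "(nat \<times> nat) multiset \<Rightarrow> series" where
  "e_mset B = (\<Prod>(i, b)\<in>#B. elementary i 1 b)"

definition weight :: "(nat \<times> nat) multiset \<Rightarrow> nat" where
  "weight B = (\<Sum>(i, b)\<in>#B. i * b)"

definition block_msets :: "nat \<Rightarrow> (nat \<times> nat) multiset set" where
  "block_msets n = {B. (\<forall>(i, b)\<in>#B. 0 < i \<and> 0 < b) \<and> weight B = n}"

lemma block_product_simps [simp]:
  "h_mset {#} = 1" "h_mset (add_mset (i, b) B) = complete_h i b * h_mset B"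
  "h_mset (B + C) = h_mset B * h_mset C"
  "e_mset {#} = 1" "e_mset (add_mset (i, b) B) = elementary i 1 b * e_mset B"
  "weight {#} = 0" "weight (add_mset (i, b) B) = i * b + weight B"
  "weight (B + C) = weight B + weight C"
  by (simp_all add: h_mset_def e_mset_def weight_def)

lemma block_msets_add: "B \<in> block_msets m \<Longrightarrow> C \<in> block_msets n \<Longrightarrow> B + C \<in> block_msets (m + n)"
  by (auto simp: block_msets_def)

lemma weight_ge: "x \<in># B \<Longrightarrow> fst x * snd x \<le> weight B"
  by (induction B) auto

lemma finite_block_msets: "finite (block_msets n)"
proof (rule finite_subset)
  show "block_msets n \<subseteq> mset ` {xs. set xs \<subseteq> {..n} \<times> {..n} \<and> length xs \<le> n}"
  proof
    fix B assume B: "B \<in> block_msets n"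
    obtain xs where xs: "B = mset xs" by (metis ex_mset)
    have "x \<in> {..n} \<times> {..n}" if "x \<in># B" for x
    proof -
      obtain i b where x: "x = (i, b)" by (cases x)
      then have "0 < i" "0 < b" "i * b \<le> n"
        using that B weight_ge[OF that] by (auto simp: block_msets_def)
      then have "i \<le> n" "b \<le> n"
        using le_trans[OF mult_le_mono2[of 1 b i], of n] le_trans[OF mult_le_mono1[of 1 i b], of n]
        by simp_all
      then show ?thesis unfolding x by simp
    qed
    moreover have "size B \<le> weight B" if "\<forall>(i, b)\<in>#B. 0 < i \<and> 0 < b" for B
      using that
    proof (induction B)
      case (add x B)
      obtain i b where x: "x = (i, b)" by (cases x)
      then have "0 < i * b" "size B \<le> weight B" using add by auto
      then show ?case unfolding x block_product_simps size_add_mset by linarith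
    qed simp
    then have "size B \<le> n" using B by (auto simp: block_msets_def)
    ultimately show "B \<in> mset ` {xs. set xs \<subseteq> {..n} \<times> {..n} \<and> length xs \<le> n}"
      using xs by auto
  qed
qed (simp add: finite_lists_length_le)

text \<open>For the partition in row \<open>i\<close>, this is the sum of the first \<open>k\<close>
  parts of its conjugate. Comparing all these numbers is the dominance order of the conjugates, row
  by row.\<close>

definition truncated_size :: "(nat \<times> nat) multiset \<Rightarrow> nat \<Rightarrow> nat \<Rightarrow> nat" where
  "truncated_size B i k = (\<Sum>(i', b)\<in>#B. if i' = i then min k b else 0)"

lemma truncated_size_simps [simp]:
  "truncated_size {#} i k = 0"
  "truncated_size (add_mset (i', b) B) i k = (if i' = i then min k b else 0) + truncated_size B i k"
  by (simp_all add: truncated_size_def)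

text \<open>The second difference of \<open>min k b\<close> in \<open>k\<close> is -1 at
  \<open>k = b\<close> and 0 at every other positive \<open>k\<close>.\<close>

lemma count_eq_truncated_size:
  "0 < k \<Longrightarrow> 2 * truncated_size B i k
    = truncated_size B i (k - 1) + truncated_size B i (k + 1) + count B (i, k)"
proof (induction B)
  case (add x B)
  then show ?case by (cases x) auto
qed simp

lemma block_msets_eqI:
  assumes "B \<in> block_msets n" "C \<in> block_msets n" "truncated_size B = truncated_size C"
  shows "B = C"
proof (rule multiset_eqI)
  fix x :: "nat \<times> nat"
  obtain i k where x: "x = (i, k)" by (cases x)
  show "count B x = count C x"
  proof (cases "k = 0")
    case True
    then have "x \<notin># B" "x \<notin># C" using assms by (auto simp: block_msets_def x)
    then show ?thesis by (simp add: not_in_iff)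
  next
    case False
    then show ?thesis
      using count_eq_truncated_size[of k B i] count_eq_truncated_size[of k C i] assms(3) by (simp add: x)
  qed
qed

lemma coeff_elementary_nonzero:
  assumes "coeff (elementary i 1 b) M \<noteq> 0" "finite J"
  shows "(\<Sum>j\<in>J. lookup M (i', j)) \<le> (if i' = i then min (card J) b else 0)"
proof -
  have M: "keys M \<subseteq> {i} \<times> {1..}" "\<forall>v\<in>keys M. lookup M v = 1" "card (keys M) = b"
    using assms(1) by (auto simp: elementary_def split: if_splits)
  have l: "lookup M v = (if v \<in> keys M then 1 else 0)" for v
    using M(2) by (auto simp: in_keys_iff)
  have "(\<Sum>j\<in>J. lookup M (i', j)) = card (J \<inter> {j. (i', j) \<in> keys M})"
    using assms(2) by (simp add: l sum.If_cases)
  also have "\<dots> \<le> (if i' = i then min (card J) b else 0)"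
  proof (cases "i' = i")
    case True
    have "card (J \<inter> {j. (i', j) \<in> keys M}) = card (Pair i' ` (J \<inter> {j. (i', j) \<in> keys M}))"
      by (simp add: card_image inj_on_def)
    also have "\<dots> \<le> card (keys M)" by (intro card_mono) auto
    finally show ?thesis using True M(3) assms(2) by (simp add: card_mono)
  next
    case False
    then have "J \<inter> {j. (i', j) \<in> keys M} = {}" using M(1) by auto
    then show ?thesis by simp
  qed
  finally show ?thesis .
qed

text \<open>A factor e_b of row \<open>i\<close> contributes at most \<open>min (card J) b\<close>
  to the exponents at \<open>J\<close>, being square-free with \<open>b\<close> variables; factors
  of other rows contribute nothing.\<close>

lemma coeff_e_mset_nonzero:
  assumes "coeff (e_mset B) M \<noteq> 0" "finite J"
  shows "(\<Sum>j\<in>J. lookup M (i, j)) \<le> truncated_size B i (card J)"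
  using assms(1)
proof (induction B arbitrary: M)
  case empty
  then show ?case by (auto split: if_splits)
next
  case (add x B)
  obtain i' b where x: "x = (i', b)" by (cases x)
  have "coeff (elementary i' 1 b * e_mset B) M \<noteq> 0" using add.prems by (simp add: x)
  then have "\<exists>y\<in>{(a, c). a + c = M}. (case y of (a, c) \<Rightarrow> coeff (elementary i' 1 b) a * coeff (e_mset B) c) \<noteq> 0"
    unfolding coeff_mult by (metis (no_types, lifting) sum.neutral)
  then obtain a c where M: "M = a + c"
    and nz: "coeff (elementary i' 1 b) a \<noteq> 0" "coeff (e_mset B) c \<noteq> 0" by auto
  show ?case
    using coeff_elementary_nonzero[OF nz(1) assms(2), of i] add.IH[OF nz(2)]
    by (auto simp: M x lookup_add sum.distrib split: if_splits)
qed

text \<open>Each factor e_b of row \<open>i\<close> supplies x_i1 ... x_ib, which attains the bound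
  of \<open>coeff_e_mset_nonzero\<close> for every \<open>J = {1..k}\<close> at once.\<close>

definition leading_monom :: "(nat \<times> nat) multiset \<Rightarrow> monom" where
  "leading_monom B = (\<Sum>(i, b)\<in>#B. constant_monom 1 ({i} \<times> {1..b}))"

lemma sum_leading_monom:
  "(\<Sum>j=1..k. lookup (leading_monom B) (i, j)) = truncated_size B i k"
proof (induction B)
  case (add x B)
  obtain i' b where x: "x = (i', b)" by (cases x)
  have "(\<Sum>j=1..k. lookup (constant_monom 1 ({i'} \<times> {1..b})) (i, j))
      = (\<Sum>j=1..k. if i' = i \<and> j \<le> b then 1 else 0)"
    by (intro sum.cong refl) (auto simp: lookup_constant_monom)
  also have "\<dots> = card ({1..k} \<inter> {j. i' = i \<and> j \<le> b})"
    by (subst sum.If_cases) simp_all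
  also have "{1..k} \<inter> {j. i' = i \<and> j \<le> b} = (if i' = i then {1..min k b} else {})" by auto
  finally show ?case
    using add by (simp add: x leading_monom_def lookup_add sum.distrib)
qed (simp add: leading_monom_def)

text \<open>This excludes cancellation, so that for the leading coefficient positivity can be
  tracked instead of the value.\<close>

lemma coeff_e_mset_nonneg: "0 \<le> coeff (e_mset B) M"
proof (induction B arbitrary: M)
  case (add x B)
  then show ?case
    by (cases x) (auto simp: coeff_mult elementary_def intro!: sum_nonneg)
qed simp

lemma coeff_e_mset_leading_monom:
  assumes "\<forall>(i, b)\<in>#B. 0 < i \<and> 0 < b"
  shows "0 < coeff (e_mset B) (leading_monom B)"
  using assms
proof (induction B)
  case (add x B)
  obtain i b where x: "x = (i, b)" by (cases x)
  let ?a = "constant_monom 1 ({i} \<times> {1..b})" and ?c = "leading_monom B"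
  have "coeff (elementary i 1 b) ?a = 1"
    by (auto simp: elementary_def keys_constant_monom lookup_constant_monom card_cartesian_product)
  then have pos: "0 < coeff (elementary i 1 b) ?a * coeff (e_mset B) ?c"
    using add by (simp add: x)
  have nonneg: "0 \<le> coeff (elementary i 1 b) a * coeff (e_mset B) c" for a c
    using coeff_e_mset_nonneg[of B c] by (simp add: elementary_def)
  have "0 < (\<Sum>y | fst y + snd y = ?a + ?c. coeff (elementary i 1 b) (fst y) * coeff (e_mset B) (snd y))"
    using finite_splittings[of "?a + ?c"] pos nonneg
    by (intro sum_pos2[of _ "(?a, ?c)"]) (auto simp: case_prod_unfold)
  then show ?case
    by (simp add: x coeff_mult case_prod_unfold leading_monom_def)
qed (simp add: leading_monom_def)

text \<open>Triangularity: the leading monomial of \<open>B\<close> occurs in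
  \<open>e_mset C\<close> only if \<open>C\<close> dominates \<open>B\<close> in all truncated
  sizes. For a maximal \<open>B\<close> with nonzero coefficient it thus occurs in a single term of
  the relation.\<close>

lemma e_mset_coefficients_zero:
  assumes zero: "(\<Sum>B\<in>block_msets n. scale (c B) (e_mset B)) = 0"
  shows "\<forall>B\<in>block_msets n. c B = 0"
proof (rule ccontr)
  assume nonzero: "\<not> (\<forall>B\<in>block_msets n. c B = 0)"
  define S where "S = {B \<in> block_msets n. c B \<noteq> 0}"
  define R where "R B C \<longleftrightarrow> (\<forall>i k. truncated_size B i k \<le> truncated_size C i k) \<and> B \<noteq> C" for B C
  have S: "finite S" "S \<noteq> {}" using finite_block_msets nonzero by (auto simp: S_def)
  have anti: "B = C" if "B \<in> S" "C \<in> S" "\<forall>i k. truncated_size B i k \<le> truncated_size C i k"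
    "\<forall>i k. truncated_size C i k \<le> truncated_size B i k" for B C
    using that by (intro block_msets_eqI[of B n C]) (auto simp: S_def fun_eq_iff intro: order_antisym)
  have "asymp_on S R" by (rule asymp_onI) (use anti in \<open>unfold R_def, metis\<close>)
  moreover have "transp_on S R"
    using anti unfolding transp_on_def R_def by (metis order_trans)
  ultimately obtain B where B: "B \<in> S" "\<forall>C\<in>S. C \<noteq> B \<longrightarrow> \<not> R B C"
    using Finite_Set.bex_max_element[OF S(1)] S(2) by metis
  have other: "c C * coeff (e_mset C) (leading_monom B) = 0" if "C \<in> block_msets n" "C \<noteq> B" for C
  proof (rule ccontr)
    assume nz: "c C * coeff (e_mset C) (leading_monom B) \<noteq> 0"
    then have "C \<in> S" using that by (simp add: S_def)
    moreover have "truncated_size B i k \<le> truncated_size C i k" for i k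
      using coeff_e_mset_nonzero[of C "leading_monom B" "{1..k}" i] nz
      by (simp add: sum_leading_monom[simplified])
    ultimately show False using B that by (auto simp: R_def)
  qed
  have "0 = (\<Sum>C\<in>block_msets n. c C * coeff (e_mset C) (leading_monom B))"
    using arg_cong[OF zero, of "\<lambda>f. coeff f (leading_monom B)"] by simp
  also have "\<dots> = (\<Sum>C\<in>{B}. c C * coeff (e_mset C) (leading_monom B))"
    using B(1) other finite_block_msets by (intro sum.mono_neutral_right) (auto simp: S_def)
  finally have "c B * coeff (e_mset B) (leading_monom B) = 0" by simp
  then show False
    using B(1) coeff_e_mset_leading_monom[of B] by (auto simp: S_def block_msets_def)
qed

lemma e_mset_independent:
  "inj_on e_mset (block_msets n)" "series.independent (e_mset ` block_msets n)"
proof -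
  show inj: "inj_on e_mset (block_msets n)"
  proof (rule inj_onI, rule ccontr)
    fix B C assume BC: "B \<in> block_msets n" "C \<in> block_msets n" "e_mset B = e_mset C" "B \<noteq> C"
    \<comment> \<open>If two e-products coincided, their difference would be a relation with
      coefficients 1 and -1.\<close>
    define c where "c D = (if D = B then 1 else 0) - (if D = C then 1 else (0 :: rat))" for D
    have "(\<Sum>D\<in>block_msets n. scale (c D) (e_mset D)) = e_mset B - e_mset C"
      using BC finite_block_msets[of n]
      by (simp add: c_def series.scale_left_diff_distrib sum_subtractf if_distrib[of "\<lambda>x. scale x _"]
          if_distribR cong: if_cong)
    then have "\<forall>D\<in>block_msets n. c D = 0" using BC by (intro e_mset_coefficients_zero) simp
    then show False using BC by (auto simp: c_def)
  qed
  show "series.independent (e_mset ` block_msets n)"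
  proof (rule series.independent_if_scalars_zero)
    fix f x assume *: "(\<Sum>x\<in>e_mset ` block_msets n. scale (f x) x) = 0" "x \<in> e_mset ` block_msets n"
    have "(\<Sum>B\<in>block_msets n. scale (f (e_mset B)) (e_mset B)) = 0"
      using *(1) by (simp add: sum.reindex[OF inj])
    from e_mset_coefficients_zero[OF this] show "f x = 0" using *(2) by blast
  qed (simp add: finite_block_msets)
qed

section \<open>Passage from e-products to h-products\<close>

lemma scale_mult_left: "scale c f * g = scale c (f * g)"
  by (rule series_eqI) (simp add: coeff_mult sum_distrib_left case_prod_unfold mult.assoc)

text \<open>Bilinearity reduces the claim to basis elements, one argument at a time, and these
  multiply by union of multisets.\<close>

lemma span_h_mset_mult:
  assumes x: "x \<in> series.span (h_mset ` block_msets m)" and y: "y \<in> series.span (h_mset ` block_msets n)"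
  shows "x * y \<in> series.span (h_mset ` block_msets (m + n))"
proof -
  let ?V = "series.span (h_mset ` block_msets (m + n))"
  have subspace: "series.subspace {x. x * y \<in> ?V}" for y
    by (rule series.subspaceI)
      (auto simp: distrib_right scale_mult_left intro: series.span_zero series.span_add series.span_scale)
  have "z * h_mset C \<in> ?V" if C: "C \<in> block_msets n" and z: "z \<in> series.span (h_mset ` block_msets m)" for z C
  proof (rule series.span_induct[OF z subspace])
    fix z assume "z \<in> h_mset ` block_msets m"
    then obtain B where B: "B \<in> block_msets m" "z = h_mset B" by blast
    then have "z * h_mset C = h_mset (B + C)" by simp
    then show "z * h_mset C \<in> ?V"
      using block_msets_add[OF B(1) C] by (simp only: series.span_base imageI)
  qed
  then have "y * x \<in> ?V"
    using x by (intro series.span_induct[OF y subspace]) (auto simp: mult.commute)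
  then show ?thesis by (simp add: mult.commute)
qed

lemma h_list_eq_h_mset: "h_list i \<beta> = h_mset (mset (map (Pair i) \<beta>))"
  by (induction \<beta>) simp_all

lemma elementary_in_span:
  assumes "0 < i"
  shows "elementary i 1 b \<in> series.span (h_mset ` block_msets (i * b))"
proof -
  have "h_list i \<beta> \<in> h_mset ` block_msets (i * b)" if "\<beta> \<in> compositions b" for \<beta>
  proof -
    have "weight (mset (map (Pair i) \<beta>)) = i * sum_list \<beta>" for \<beta>
      by (induction \<beta>) (simp_all add: algebra_simps)
    then have "mset (map (Pair i) \<beta>) \<in> block_msets (i * b)"
      using that assms by (auto simp: block_msets_def compositions_def composition_def)
    then show ?thesis unfolding h_list_eq_h_mset by blast
  qed
  then have "signed_elementary i b \<in> series.span (h_mset ` block_msets (i * b))"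
    unfolding signed_elementary_eq_compositions of_int_mult_eq_scale
    by (intro series.span_sum series.span_scale series.span_base)
  moreover have "elementary i 1 b = of_int ((-1) ^ b) * signed_elementary i b"
    by (simp add: signed_elementary_def flip: mult.assoc power_add)
  ultimately show ?thesis
    unfolding of_int_mult_eq_scale by (simp only: series.span_scale)
qed

lemma e_mset_in_span:
  assumes "B \<in> block_msets n"
  shows "e_mset B \<in> series.span (h_mset ` block_msets n)"
proof -
  have "e_mset B \<in> series.span (h_mset ` block_msets (weight B))" if "\<forall>(i, b)\<in>#B. 0 < i \<and> 0 < b" for B
    using that
  proof (induction B)
    case empty
    have "{#} \<in> block_msets 0" by (simp add: block_msets_def)
    then have "h_mset {#} \<in> series.span (h_mset ` block_msets 0)" by (intro series.span_base) blast
    then show ?case by simp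
  next
    case (add x B)
    then show ?case
      by (cases x) (auto intro!: span_h_mset_mult elementary_in_span[simplified])
  qed
  then show ?thesis using assms by (auto simp: block_msets_def)
qed

text \<open>
  The \<open>e\<close>-products lie in the span of the \<open>h\<close>-products, and there are as many of the former as of
  the latter.
\<close>

lemma h_mset_independent:
  "inj_on h_mset (block_msets n)" "series.independent (h_mset ` block_msets n)"
proof -
  let ?e = "e_mset ` block_msets n" and ?h = "h_mset ` block_msets n"
  \<comment> \<open>A set spanning all h-products spans the independent e-products too. Taking
    \<open>T\<close> to be all h-products yields injectivity; omitting a dependent one would leave
    too few.\<close>
  have bound: "card (block_msets n) \<le> card T" if "finite T" "?h \<subseteq> series.span T" for T
  proof -
    have "series.span ?h \<subseteq> series.span T"
      using that by (intro series.span_minimal series.subspace_span)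
    then have "?e \<subseteq> series.span T" using e_mset_in_span by blast
    then have "card ?e \<le> card T"
      using series.independent_span_bound[OF that(1) e_mset_independent(2)] by blast
    then show ?thesis by (simp add: card_image[OF e_mset_independent(1)])
  qed
  have "card (block_msets n) \<le> card ?h"
    by (rule bound[OF finite_imageI[OF finite_block_msets] series.span_superset])
  then have card: "card ?h = card (block_msets n)"
    using card_image_le[OF finite_block_msets, of h_mset n] by simp
  then show "inj_on h_mset (block_msets n)"
    by (rule eq_card_imp_inj_on[OF finite_block_msets])
  show "series.independent ?h"
  proof
    assume "series.dependent ?h"
    then obtain a where a: "a \<in> ?h" "a \<in> series.span (?h - {a})"
      unfolding series.dependent_def by blast
    have "?h \<subseteq> insert a (?h - {a})" by blast
    also have "\<dots> \<subseteq> series.span (?h - {a})"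
      by (rule insert_subsetI[OF a(2) series.span_superset])
    finally have "card (block_msets n) \<le> card (?h - {a})"
      by (rule bound[rotated]) (rule finite_Diff[OF finite_imageI[OF finite_block_msets]])
    moreover have "card (?h - {a}) < card ?h"
      by (rule card_Diff1_less[OF finite_imageI[OF finite_block_msets] a(1)])
    ultimately show False using card by simp
  qed
qed

section \<open>Types as multisets of blocks\<close>

lemma count_blocks:
  assumes "finite (supp \<tau>)"
  shows "count (blocks \<tau>) (i, b) = count (mset (\<tau> i)) b"
proof -
  have *: "count (image_mset (Pair d) M) (i, b) = (if d = i then count M b else 0)"
    for d and M :: "nat multiset"
    by (induction M) auto
  have "count (blocks \<tau>) (i, b) = (\<Sum>d\<in>supp \<tau>. if d = i then count (mset (\<tau> d)) b else 0)"
    by (simp add: blocks_def count_sum *)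
  also have "\<dots> = count (mset (\<tau> i)) b"
    using assms by (simp add: supp_def)
  finally show ?thesis .
qed

lemma h_tensor_eq_h_mset: "finite (supp \<delta>) \<Longrightarrow> h_tensor \<delta> = h_mset (blocks \<delta>)"
proof -
  have "h_mset (\<Sum>d\<in>S. image_mset (Pair d) (mset (\<delta> d))) = (\<Prod>d\<in>S. h_list d (\<delta> d))" if "finite S" for S
    using that by (induction S rule: finite_induct) (simp_all add: h_list_eq_h_mset)
  then show "finite (supp \<delta>) \<Longrightarrow> ?thesis" by (simp add: h_tensor_def blocks_def)
qed

lemma weight_sum_image_mset:
  assumes "finite S"
  shows "weight (\<Sum>d\<in>S. image_mset (Pair d) (mset (\<delta> d))) = (\<Sum>d\<in>S. d * area (\<delta> d))"
proof -
  have "weight (image_mset (Pair d) (mset \<beta>)) = d * sum_list \<beta>" for d \<beta>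
    by (induction \<beta>) (simp_all add: algebra_simps)
  with assms show ?thesis by (induction S rule: finite_induct) simp_all
qed

lemma blocks_ordered_types:
  assumes "\<delta> \<in> ordered_types n"
  shows "blocks \<delta> \<in> block_msets n"
proof -
  have "0 < i \<and> 0 < b" if "(i, b) \<in># blocks \<delta>" for i b
  proof -
    have "b \<in> set (\<delta> i)"
      using that assms count_blocks[of \<delta> i b]
      by (metis (no_types, lifting) count_greater_zero_iff mem_Collect_eq ordered_types_def set_mset_mset)
    then show ?thesis
      using assms by (cases "i = 0") (auto simp: ordered_types_def composition_def)
  qed
  then show ?thesis
    using assms weight_sum_image_mset[of "supp \<delta>" \<delta>]
    by (auto simp: block_msets_def ordered_types_def simp flip: blocks_def)
qed

text \<open>The content condition of \<open>tabloids\<close> can thus be read on the unsorted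
  contents, which are the indices of the h-products in the expansion.\<close>

lemma blocks_psort: "blocks (psort \<gamma>) = blocks \<gamma>"
proof -
  have "psort \<gamma> d = [] \<longleftrightarrow> \<gamma> d = []" for d
    unfolding psort_def by (metis mset_rev mset_sort mset_zero_iff)
  then have "supp (psort \<gamma>) = supp \<gamma>" by (simp add: supp_def)
  then show ?thesis by (simp add: blocks_def psort_def)
qed

lemma bij_betw_blocks: "bij_betw blocks (types n) (block_msets n)"
proof (rule bij_betw_imageI)
  show "inj_on blocks (types n)"
  proof (rule inj_onI)
    fix \<sigma> \<tau> assume \<sigma>\<tau>: "\<sigma> \<in> types n" "\<tau> \<in> types n" "blocks \<sigma> = blocks \<tau>"
    show "\<sigma> = \<tau>"
    proof
      fix i
      have "mset (\<sigma> i) = mset (\<tau> i)"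
        using \<sigma>\<tau> count_blocks[of \<sigma> i] count_blocks[of \<tau> i]
        by (intro multiset_eqI) (simp add: types_def ordered_types_def)
      then have "mset (rev (\<sigma> i)) = mset (rev (\<tau> i))" by simp
      moreover have "sorted (rev (\<sigma> i))" "sorted (rev (\<tau> i))"
        using \<sigma>\<tau> by (auto simp: types_def is_partition_def sorted_wrt_rev)
      ultimately show "\<sigma> i = \<tau> i"
        by (metis properties_for_sort rev_rev_ident sort_key_id_if_sorted)
    qed
  qed
  show "blocks ` types n = block_msets n"
  proof (intro equalityI subsetI)
    fix B assume "B \<in> blocks ` types n"
    then show "B \<in> block_msets n" using blocks_ordered_types by (auto simp: types_def)
  next
    fix B assume B: "B \<in> block_msets n"
    define \<tau> where "\<tau> i = rev (sorted_list_of_multiset (image_mset snd (filter_mset (\<lambda>x. fst x = i) B)))" for i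
    have mset_\<tau>: "mset (\<tau> i) = image_mset snd (filter_mset (\<lambda>x. fst x = i) B)" for i
      by (simp add: \<tau>_def)
    have supp: "supp \<tau> = fst ` set_mset B"
    proof (rule Set.set_eqI)
      fix i
      have "i \<in> supp \<tau> \<longleftrightarrow> mset (\<tau> i) \<noteq> {#}" by (simp add: supp_def)
      also have "\<dots> \<longleftrightarrow> (\<exists>x\<in>#B. fst x = i)"
        by (force simp: mset_\<tau> simp flip: set_mset_eq_empty_iff)
      finally show "i \<in> supp \<tau> \<longleftrightarrow> i \<in> fst ` set_mset B" by auto
    qed
    have fin: "finite (supp \<tau>)" by (simp add: supp)
    have eq: "blocks \<tau> = B"
    proof (rule multiset_eqI)
      fix x :: "nat \<times> nat"
      obtain i b where x: "x = (i, b)" by (cases x)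
      have "count (image_mset snd (filter_mset (\<lambda>x. fst x = i) B)) b = count B (i, b)" for B :: "(nat \<times> nat) multiset"
        by (induction B) auto
      then show "count (blocks \<tau>) x = count B x"
        by (simp add: x count_blocks[OF fin] mset_\<tau>)
    qed
    have pos: "0 < i \<and> 0 < b" if "b \<in> set (\<tau> i)" for i b
    proof -
      have "b \<in># mset (\<tau> i)" using that by simp
      then show ?thesis using B unfolding mset_\<tau> by (auto simp: block_msets_def)
    qed
    have "(\<Sum>i\<in>supp \<tau>. i * area (\<tau> i)) = n"
      using weight_sum_image_mset[OF fin, of \<tau>] B eq by (simp add: block_msets_def flip: blocks_def)
    moreover have "\<tau> 0 = []" using pos[of _ 0] by (cases "\<tau> 0") auto
    moreover have "is_partition (\<tau> i)" for i
      using pos[of _ i] by (auto simp: is_partition_def composition_def \<tau>_def sorted_wrt_rev)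
    ultimately have "\<tau> \<in> types n"
      using fin by (simp add: types_def ordered_types_def is_partition_def)
    then show "B \<in> blocks ` types n" using eq by blast
  qed
qed

lemma h_tensor_image: "h_tensor ` types n = h_mset ` block_msets n"
proof -
  have "h_tensor ` types n = (\<lambda>\<tau>. h_mset (blocks \<tau>)) ` types n"
    by (intro image_cong refl h_tensor_eq_h_mset) (simp add: types_def ordered_types_def)
  also have "\<dots> = h_mset ` block_msets n"
    unfolding bij_betw_imp_surj_on[OF bij_betw_blocks, symmetric] by (rule image_image[symmetric])
  finally show ?thesis .
qed

text \<open>Multiplying the block expansions gives one term per list of labeled polywrappings,
  namely its sign times the h-product of its content; independence of the h-products isolates the
  content \<open>\<tau>\<close>. The list \<open>bs\<close> may be any ordering of the blocks of
  \<open>\<sigma>\<close>.\<close>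

theorem theorem79:
  fixes n :: nat and \<sigma> \<tau> :: otype and bs :: "(nat \<times> nat) list"
  assumes "n > 0" and "\<sigma> \<in> types n" and "\<tau> \<in> types n"
    and "mset bs = blocks \<sigma>"
  shows "h_coefficient n (E_plus \<sigma>) \<tau> = of_int (\<Sum>T\<in>tabloids bs \<tau>. psgn_tabloid bs T)"
proof -
  let ?LP = "\<lambda>(d, r). labeled_polywrappings d r"
  let ?H = "h_mset ` block_msets n"
  define \<T> where "\<T> = {T. list_all2 (\<lambda>D b. D \<in> ?LP b) T bs}"
  define content where "content T = (\<Sum>D\<leftarrow>T. blocks (pocon D))" for T :: "labeled_polywrapping list"
  have \<sigma>: "blocks \<sigma> \<in> block_msets n"
    using assms(2) by (intro blocks_ordered_types) (simp add: types_def)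
  have bs_pos: "0 < d \<and> 0 < r" if "(d, r) \<in> set bs" for d r
  proof -
    have "(d, r) \<in># mset bs" using that by simp
    then show ?thesis using \<sigma> assms(4) by (auto simp: block_msets_def)
  qed
  have tab: "tabloids bs \<tau> = {T \<in> \<T>. content T = blocks \<tau>}"
    by (simp add: tabloids_def \<T>_def content_def blocks_psort case_prod_unfold)
  let ?g = "\<lambda>(d, r) D. of_int (psgn_polywrapping r D) * h_tensor (pocon D)"
  have fin_LP: "finite (?LP x)" if "x \<in> set bs" for x
    using that bs_pos by (auto intro!: E_plus_block_eq_labeled_polywrappings(1) split: prod.splits)
  have fin: "finite \<T>"
    and prod: "(\<Prod>x\<leftarrow>bs. \<Sum>D\<in>?LP x. ?g x D) = (\<Sum>T\<in>\<T>. \<Prod>(x, D)\<leftarrow>zip bs T. ?g x D)"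
    using prod_list_sum_list_all2[of bs ?LP ?g, OF fin_LP] by (simp_all only: \<T>_def)
  \<comment> \<open>The degree is written as \<open>weight (mset bs)\<close> instead of
    \<open>n\<close>, since \<open>bs\<close> shrinks in the induction.\<close>
  have expand: "content T \<in> block_msets (weight (mset bs))
      \<and> (\<Prod>(x, D)\<leftarrow>zip bs T. ?g x D) = of_int (psgn_tabloid bs T) * h_mset (content T)"
    if "T \<in> \<T>" for T
  proof -
    have "list_all2 (\<lambda>D b. D \<in> ?LP b) T bs" using that by (simp add: \<T>_def)
    then show ?thesis
    proof (induction T bs rule: list_all2_induct)
      case Nil
      then show ?case by (simp add: content_def block_msets_def psgn_tabloid_def)
    next
      case (Cons D T x xs)
      obtain d r where x: "x = (d, r)" by (cases x)
      have D: "pocon D \<in> ordered_types (d * r)"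
        using Cons by (simp add: x labeled_polywrappings_def OTyp_def)
      have "content (D # T) = blocks (pocon D) + content T" by (simp add: content_def)
      moreover have "h_tensor (pocon D) = h_mset (blocks (pocon D))"
        using D by (intro h_tensor_eq_h_mset) (simp add: ordered_types_def)
      ultimately show ?case
        using Cons.IH blocks_ordered_types[OF D]
        by (auto simp: x psgn_tabloid_def intro: block_msets_add)
    qed
  qed
  have content: "content T \<in> block_msets n" if "T \<in> \<T>" for T
    using expand[OF that] \<sigma> assms(4) by (simp add: block_msets_def)
  have "E_plus \<sigma> = (\<Prod>(d, r)\<leftarrow>bs. E_plus_block d r)"
    by (simp add: E_plus_def assms(4)[symmetric] prod_mset_prod_list flip: mset_map)
  also have "\<dots> = (\<Prod>x\<leftarrow>bs. \<Sum>D\<in>?LP x. ?g x D)"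
    using bs_pos by (intro arg_cong[of _ _ prod_list] map_cong refl)
      (auto simp: E_plus_block_eq_labeled_polywrappings(2))
  also have "\<dots> = (\<Sum>T\<in>\<T>. scale (of_int (psgn_tabloid bs T)) (h_mset (content T)))"
    unfolding prod of_int_mult_eq_scale[symmetric] using expand by (intro sum.cong) auto
  finally have E: "E_plus \<sigma> = \<dots>" .
  have ind: "series.independent ?H" by (rule h_mset_independent)
  have \<tau>: "blocks \<tau> \<in> block_msets n" "h_tensor \<tau> = h_mset (blocks \<tau>)"
    using assms(3) blocks_ordered_types h_tensor_eq_h_mset by (auto simp: types_def ordered_types_def)
  have span: "h_mset (content T) \<in> series.span ?H" if "T \<in> \<T>" for T
    using content[OF that] by (intro series.span_base) blast
  have "h_coefficient n (E_plus \<sigma>) \<tau>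
      = (\<Sum>T\<in>\<T>. of_int (psgn_tabloid bs T) * series.representation ?H (h_mset (content T)) (h_mset (blocks \<tau>)))"
    unfolding h_coefficient_def h_tensor_image E \<tau>(2)
    by (subst series.representation_sum[OF ind])
      (auto simp: span series.span_scale series.representation_scale[OF ind])
  also have "\<dots> = (\<Sum>T\<in>\<T>. if content T = blocks \<tau> then of_int (psgn_tabloid bs T) else 0)"
  proof (rule sum.cong[OF refl])
    fix T assume T: "T \<in> \<T>"
    have "series.representation ?H (h_mset (content T)) (h_mset (blocks \<tau>))
        = (if h_mset (blocks \<tau>) = h_mset (content T) then 1 else 0)"
      using content[OF T] by (subst series.representation_basis[OF ind]) auto
    \<comment> \<open>\<open>representation\<close> compares series; injectivity of
      \<open>h_mset\<close> turns this into a comparison of contents.\<close>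
    also have "h_mset (blocks \<tau>) = h_mset (content T) \<longleftrightarrow> content T = blocks \<tau>"
      using inj_on_eq_iff[OF h_mset_independent(1) \<tau>(1) content[OF T]] by auto
    finally show "of_int (psgn_tabloid bs T) * series.representation ?H (h_mset (content T)) (h_mset (blocks \<tau>))
        = (if content T = blocks \<tau> then of_int (psgn_tabloid bs T) else 0)" by simp
  qed
  also have "\<dots> = of_int (\<Sum>T\<in>tabloids bs \<tau>. psgn_tabloid bs T)"
    unfolding tab of_int_sum using fin by (intro sum.mono_neutral_cong_right) auto
  finally show ?thesis .
qed

end
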